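(* Let $(M,h^M)$ be a three-dimensional oriented Riemannian manifold of constant curvature, let $\varepsilon>0$, and let $\alpha_t:S^1\to M$, $t\in(-\varepsilon,\varepsilon)$, be a (smooth) time-dependent embedding such that: (i) $(\mathrm{Trace}\,\Pi_{\Sigma_t})(\alpha_t(s))\neq 0$ for all $s\in S^1$ and all $t\in(-\varepsilon,\varepsilon)$, where $\Sigma_t=\alpha_t(S^1)$ and $\Pi_{\Sigma_t}$ is the second fundamental form of $\Sigma_t$ in $M$; (ii) $\alpha_t$ is parameterized by arclength, i.e. $\left\|\frac{d}{ds}\alpha_t(s)\right\|=1$ for all $s\in S^1$ and all $t\in(-\varepsilon,\varepsilon)$; (iii) $\alpha_t$ is a solution of the vortex filament equation $\frac{d}{dt}\alpha_t=\kappa\cdot B$, where $\kappa$ and $B$ are the curvature and the binormal of $\alpha_t$. Let $\tau$ be the torsion of $\alpha_t$, and consider $$\psi_t:S^1\to\mathbb{C},\qquad s\mapsto \kappa(s)\,e^{i\int_0^s\tau(x)\,dx}.$$ Then $$-i\,\frac{\partial\psi}{\partial t}=\frac{\partial^2\psi}{\partial s^2}+\frac12|\psi|^2\,\psi-\psi\cdot A(t),\qquad\text{where}\quad A(t):=\left(\frac{1}{\kappa}\frac{\partial^2\kappa}{\partial s^2}-\tau^2+\frac12\kappa^2\right)(s)\bigg|_{s=0}.$$ Moreover, setting $$\Psi_t(s):=e^{i\int_0^tA(x)\,dx}\cdot\psi_t(s)\qquad\text{for } t\in(-\varepsilon,\varepsilon),\ s\in S^1,$$ $\Psi_t$ satisfies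 the non-linear Schrödinger equation $$-i\,\frac{\partial\Psi}{\partial t}=\frac{\partial^2\Psi}{\partial s^2}+\frac12|\Psi|^2\,\Psi .$$
   Context: For an embedded closed curve $\Sigma=\alpha(S^1)\subset M$ parameterized by arclength with $\mathrm{Trace}\,\Pi_\Sigma$ nowhere zero (the trace of the second fundamental form is a normal vector field along $\Sigma$), the Frenet frame $(T,N,B)$ along $\alpha$ is defined by $T=\dot\alpha/\|\dot\alpha\|$, $N=\mathrm{Trace}\,\Pi_\Sigma/\|\mathrm{Trace}\,\Pi_\Sigma\|$, $B=T\times N$, where $\times$ is the cross product determined by the metric and orientation of $M$. The curvature $\kappa$ and the torsion $\tau$ are the smooth real functions on $S^1$ determined by the Frenet formulas $$\frac{D}{\partial s}T=\kappa N,\qquad \frac{D}{\partial s}N=-\kappa T+\tau B,\qquad \frac{D}{\partial s}B=-\tau N,$$ where $\frac{D}{\partial s}$ is the covariant derivative along $\alpha$ induced by the Levi-Civita connection. For the family $\alpha_t$, the quantities $\kappa,\tau,T,N,B$ depend on both $s$ and $t$; the variable $s$ is the parameter on $S^1$, and $\int_0^s$ is taken from the base point $s=0$. *)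

theory Defs
  imports "HOL-Analysis.Analysis"
begin

section \<open>Smooth maps between open subsets of Euclidean spaces\<close>

text \<open>Intended for open sets only.\<close>

primrec Ck_on :: "nat \<Rightarrow> 'a::euclidean_space set \<Rightarrow> ('a \<Rightarrow> 'b::euclidean_space) \<Rightarrow> bool"
  where
    "Ck_on 0 S f \<longleftrightarrow> continuous_on S f"
  | "Ck_on (Suc k) S f \<longleftrightarrow>
       (\<forall>x\<in>S. f differentiable (at x)) \<and>
       (\<forall>v. Ck_on k S (\<lambda>x. frechet_derivative f (at x) v))"

definition smooth_on :: "'a::euclidean_space set \<Rightarrow> ('a \<Rightarrow> 'b::euclidean_space) \<Rightarrow> bool"
  where "smooth_on S f \<longleftrightarrow> (\<forall>k. Ck_on k S f)"

section \<open>Riemannian geometry in a coordinate domain\<close>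

text \<open>The argument \<open>G\<close> is the matrix of metric coefficients as a function of the coordinates.\<close>

type_synonym metric_coeffs = "real^3 \<Rightarrow> real^3^3"

definition metric_inner :: "metric_coeffs \<Rightarrow> real^3 \<Rightarrow> real^3 \<Rightarrow> real^3 \<Rightarrow> real"
  where "metric_inner G x u v = u \<bullet> (G x *v v)"

definition metric_norm :: "metric_coeffs \<Rightarrow> real^3 \<Rightarrow> real^3 \<Rightarrow> real"
  where "metric_norm G x u = sqrt (metric_inner G x u u)"

text \<open>In a positively oriented chart the Riemannian volume form is
  \<open>vol(u,v,w) = sqrt (det G) * det(u,v,w)\<close>, and \<open>u \<times> v\<close> is defined by
  \<open>\<langle>u \<times> v, w\<rangle> = vol(u,v,w)\<close> for all \<open>w\<close>.\<close>

definition metric_cross :: "metric_coeffs \<Rightarrow> real^3 \<Rightarrow> real^3 \<Rightarrow> real^3 \<Rightarrow> real^3"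
  where "metric_cross G x u v = sqrt (det (G x)) *\<^sub>R (matrix_inv (G x) *v cross3 u v)"

definition partial :: "3 \<Rightarrow> (real^3 \<Rightarrow> real) \<Rightarrow> real^3 \<Rightarrow> real"
  where "partial i f x = frechet_derivative f (at x) (axis i 1)"

text \<open>\<open>christoffel G k i j\<close> is \<open>\<Gamma>\<^sup>k\<^sub>i\<^sub>j\<close> for the Levi-Civita connection.\<close>

definition christoffel :: "metric_coeffs \<Rightarrow> 3 \<Rightarrow> 3 \<Rightarrow> 3 \<Rightarrow> real^3 \<Rightarrow> real"
  where "christoffel G k i j x =
    (1/2) * (\<Sum>l\<in>UNIV. matrix_inv (G x) $ k $ l *
      (partial i (\<lambda>y. G y $ j $ l) x + partial j (\<lambda>y. G y $ i $ l) x
       - partial l (\<lambda>y. G y $ i $ j) x))"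

text \<open>\<open>riemann_coeff G l i j k\<close> is the \<open>l\<close>-th component of \<open>R(\<partial>\<^sub>i, \<partial>\<^sub>j) \<partial>\<^sub>k\<close>, with the
  convention \<open>R(X,Y) = \<nabla>\<^sub>X \<nabla>\<^sub>Y - \<nabla>\<^sub>Y \<nabla>\<^sub>X - \<nabla>\<^bsub>[X,Y]\<^esub>\<close>.\<close>

definition riemann_coeff :: "metric_coeffs \<Rightarrow> 3 \<Rightarrow> 3 \<Rightarrow> 3 \<Rightarrow> 3 \<Rightarrow> real^3 \<Rightarrow> real"
  where "riemann_coeff G l i j k x =
    partial i (christoffel G l j k) x - partial j (christoffel G l i k) x
    + (\<Sum>m\<in>UNIV. christoffel G l i m x * christoffel G m j k x
                - christoffel G l j m x * christoffel G m i k x)"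

definition riemann :: "metric_coeffs \<Rightarrow> real^3 \<Rightarrow> real^3 \<Rightarrow> real^3 \<Rightarrow> real^3 \<Rightarrow> real^3"
  where "riemann G x u v w =
    (\<chi> l. \<Sum>i\<in>UNIV. \<Sum>j\<in>UNIV. \<Sum>k\<in>UNIV. riemann_coeff G l i j k x * u $ i * v $ j * w $ k)"

definition sectional_curvature :: "metric_coeffs \<Rightarrow> real^3 \<Rightarrow> real^3 \<Rightarrow> real^3 \<Rightarrow> real"
  where "sectional_curvature G x u v =
    metric_inner G x (riemann G x u v v) u /
    (metric_inner G x u u * metric_inner G x v v - (metric_inner G x u v)\<^sup>2)"

section \<open>Curves in a coordinate domain\<close>

text \<open>Here \<open>x\<close> is a curve in coordinates. All notions depend only on the germ of \<open>x\<close> at the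
  parameter \<open>s\<close>.\<close>

definition velocity :: "(real \<Rightarrow> real^3) \<Rightarrow> real \<Rightarrow> real^3"
  where "velocity x s = vector_derivative x (at s)"

text \<open>Covariant derivative \<open>D/\<partial>s\<close> of a vector field \<open>V\<close> along \<open>x\<close>.\<close>

definition cov_deriv ::
    "metric_coeffs \<Rightarrow> (real \<Rightarrow> real^3) \<Rightarrow> (real \<Rightarrow> real^3) \<Rightarrow> real \<Rightarrow> real^3"
  where "cov_deriv G x V s = vector_derivative V (at s)
    + (\<chi> k. \<Sum>i\<in>UNIV. \<Sum>j\<in>UNIV. christoffel G k i j (x s) * velocity x s $ i * V s $ j)"

definition unit_tangent :: "metric_coeffs \<Rightarrow> (real \<Rightarrow> real^3) \<Rightarrow> real \<Rightarrow> real^3"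
  where "unit_tangent G x s = velocity x s /\<^sub>R metric_norm G (x s) (velocity x s)"

definition normal_part :: "metric_coeffs \<Rightarrow> (real \<Rightarrow> real^3) \<Rightarrow> real \<Rightarrow> real^3 \<Rightarrow> real^3"
  where "normal_part G x s w =
    w - metric_inner G (x s) w (unit_tangent G x s) *\<^sub>R unit_tangent G x s"

text \<open>\<open>\<Pi>(u,v)\<close> is the normal part of \<open>\<nabla>\<^sub>u v\<close>. For \<open>u = a T\<close>, \<open>v = b T\<close>, with \<open>T\<close> the unit tangent,
  it equals \<open>a * b\<close> times the normal part of \<open>\<nabla>\<^sub>T T\<close>, where \<open>\<nabla>\<^sub>T\<close> is \<open>D/\<partial>s\<close> divided by the speed.\<close>

definition second_fundamental_form ::
    "metric_coeffs \<Rightarrow> (real \<Rightarrow> real^3) \<Rightarrow> real \<Rightarrow> real^3 \<Rightarrow> real^3 \<Rightarrow> real^3"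
  where "second_fundamental_form G x s u v =
    (metric_inner G (x s) u (unit_tangent G x s) * metric_inner G (x s) v (unit_tangent G x s)) *\<^sub>R
    normal_part G x s
      (cov_deriv G x (unit_tangent G x) s /\<^sub>R metric_norm G (x s) (velocity x s))"

text \<open>The tangent line has the orthonormal basis consisting of the unit tangent.\<close>

definition trace_sff :: "metric_coeffs \<Rightarrow> (real \<Rightarrow> real^3) \<Rightarrow> real \<Rightarrow> real^3"
  where "trace_sff G x s =
    second_fundamental_form G x s (unit_tangent G x s) (unit_tangent G x s)"

definition principal_normal :: "metric_coeffs \<Rightarrow> (real \<Rightarrow> real^3) \<Rightarrow> real \<Rightarrow> real^3"
  where "principal_normal G x s = trace_sff G x s /\<^sub>R metric_norm G (x s) (trace_sff G x s)"

definition binormal :: "metric_coeffs \<Rightarrow> (real \<Rightarrow> real^3) \<Rightarrow> real \<Rightarrow> real^3"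
  where "binormal G x s = metric_cross G (x s) (unit_tangent G x s) (principal_normal G x s)"

section \<open>Oriented Riemannian 3-manifolds\<close>

text \<open>A chart is a domain together with its coordinate map, whose values outside the domain are
  irrelevant. The atlas determines smooth structure and orientation; the metric is given by its
  coefficient matrices in the charts. A tangent vector at \<open>p\<close> is represented by its components in the
  charts around \<open>p\<close>, and an equation between tangent vectors is required in all of these charts
  (in one chart suffices, by the transformation laws).\<close>

type_synonym 'm chart = "'m set \<times> ('m \<Rightarrow> real^3)"

definition transition :: "'m chart \<Rightarrow> 'm chart \<Rightarrow> real^3 \<Rightarrow> real^3"
  where "transition c d = snd d \<circ> inv_into (fst c) (snd c)"

locale oriented_riemannian_3manifold =
  fixes X :: "'m topology"
    and atlas :: "'m chart set"
    and g :: "'m chart \<Rightarrow> metric_coeffs"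
  assumes Hausdorff: "Hausdorff_space X"
    and second_countable: "second_countable X"
    and charts_cover: "(\<Union>c\<in>atlas. fst c) = topspace X"
    and chart_domain: "\<And>c. c \<in> atlas \<Longrightarrow> openin X (fst c)"
    and chart_image: "\<And>c. c \<in> atlas \<Longrightarrow> open (snd c ` fst c)"
    and chart_homeomorphic: "\<And>c. c \<in> atlas \<Longrightarrow>
          homeomorphic_map (subtopology X (fst c)) (top_of_set (snd c ` fst c)) (snd c)"
    and transition_smooth: "\<And>c d. c \<in> atlas \<Longrightarrow> d \<in> atlas \<Longrightarrow>
          smooth_on (snd c ` (fst c \<inter> fst d)) (transition c d)"
    and transition_oriented: "\<And>c d p. c \<in> atlas \<Longrightarrow> d \<in> atlas \<Longrightarrow> p \<in> fst c \<inter> fst d \<Longrightarrow>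
          0 < det (matrix (frechet_derivative (transition c d) (at (snd c p))))"
    and metric_smooth: "\<And>c. c \<in> atlas \<Longrightarrow> smooth_on (snd c ` fst c) (g c)"
    and metric_symmetric: "\<And>c x. c \<in> atlas \<Longrightarrow> x \<in> snd c ` fst c \<Longrightarrow>
          transpose (g c x) = g c x"
    and metric_positive: "\<And>c x v. c \<in> atlas \<Longrightarrow> x \<in> snd c ` fst c \<Longrightarrow> v \<noteq> 0 \<Longrightarrow>
          0 < metric_inner (g c) x v v"
    and metric_compatible: "\<And>c d p u v. c \<in> atlas \<Longrightarrow> d \<in> atlas \<Longrightarrow> p \<in> fst c \<inter> fst d \<Longrightarrow>
          metric_inner (g c) (snd c p) u v =
          metric_inner (g d) (snd d p)
            (frechet_derivative (transition c d) (at (snd c p)) u)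
            (frechet_derivative (transition c d) (at (snd c p)) v)"

definition constant_curvature :: "'m chart set \<Rightarrow> ('m chart \<Rightarrow> metric_coeffs) \<Rightarrow> bool"
  where "constant_curvature atlas g \<longleftrightarrow>
    (\<exists>K. \<forall>c\<in>atlas. \<forall>x\<in>snd c ` fst c. \<forall>u v. u \<noteq> v \<and> independent {u, v} \<longrightarrow>
       sectional_curvature (g c) x u v = K)"

section \<open>Families of closed curves\<close>

text \<open>The circle is \<open>\<real> / L\<int>\<close>: a map from it is an \<open>L\<close>-periodic map on \<open>\<real>\<close>. Since the circle is compact
  and the manifold is Hausdorff, an injective immersion of the circle is an embedding.\<close>

definition time_dependent_embedding ::
    "'m topology \<Rightarrow> 'm chart set \<Rightarrow> real \<Rightarrow> real \<Rightarrow> (real \<Rightarrow> real \<Rightarrow> 'm) \<Rightarrow> bool"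
  where "time_dependent_embedding X atlas \<epsilon> L \<alpha> \<longleftrightarrow>
    (\<forall>t\<in>{-\<epsilon><..<\<epsilon>}. \<forall>s. \<alpha> t (s + L) = \<alpha> t s) \<and>
    continuous_map (top_of_set ({-\<epsilon><..<\<epsilon>} \<times> UNIV)) X (\<lambda>(t, s). \<alpha> t s) \<and>
    (\<forall>c\<in>atlas. smooth_on {(t, s). t \<in> {-\<epsilon><..<\<epsilon>} \<and> \<alpha> t s \<in> fst c} (\<lambda>(t, s). snd c (\<alpha> t s))) \<and>
    (\<forall>t\<in>{-\<epsilon><..<\<epsilon>}. inj_on (\<alpha> t) {0..<L}) \<and>
    (\<forall>t\<in>{-\<epsilon><..<\<epsilon>}. \<forall>s. \<forall>c\<in>atlas. \<alpha> t s \<in> fst c \<longrightarrow> velocity (snd c \<circ> \<alpha> t) s \<noteq> 0)"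

definition nowhere_zero_trace_sff ::
    "'m chart set \<Rightarrow> ('m chart \<Rightarrow> metric_coeffs) \<Rightarrow> (real \<Rightarrow> 'm) \<Rightarrow> bool"
  where "nowhere_zero_trace_sff atlas g \<gamma> \<longleftrightarrow>
    (\<forall>s. \<forall>c\<in>atlas. \<gamma> s \<in> fst c \<longrightarrow> trace_sff (g c) (snd c \<circ> \<gamma>) s \<noteq> 0)"

definition parameterized_by_arclength ::
    "'m chart set \<Rightarrow> ('m chart \<Rightarrow> metric_coeffs) \<Rightarrow> (real \<Rightarrow> 'm) \<Rightarrow> bool"
  where "parameterized_by_arclength atlas g \<gamma> \<longleftrightarrow>
    (\<forall>s. \<forall>c\<in>atlas. \<gamma> s \<in> fst c \<longrightarrow>
       metric_norm (g c) (snd c (\<gamma> s)) (velocity (snd c \<circ> \<gamma>) s) = 1)"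

text \<open>\<open>\<kappa>\<close> and \<open>\<tau>\<close> are the functions determined by the Frenet formulas along \<open>\<gamma>\<close>. Their smoothness and
  periodicity follow and are not part of the definition.\<close>

definition has_curvature_torsion ::
    "'m chart set \<Rightarrow> ('m chart \<Rightarrow> metric_coeffs) \<Rightarrow> (real \<Rightarrow> 'm) \<Rightarrow>
     (real \<Rightarrow> real) \<Rightarrow> (real \<Rightarrow> real) \<Rightarrow> bool"
  where "has_curvature_torsion atlas g \<gamma> \<kappa> \<tau> \<longleftrightarrow>
    (\<forall>s. \<forall>c\<in>atlas. \<gamma> s \<in> fst c \<longrightarrow>
      (let x = snd c \<circ> \<gamma>; T = unit_tangent (g c) x; N = principal_normal (g c) x;
           B = binormal (g c) x
       in cov_deriv (g c) x T s = \<kappa> s *\<^sub>R N s \<and>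
          cov_deriv (g c) x N s = - \<kappa> s *\<^sub>R T s + \<tau> s *\<^sub>R B s \<and>
          cov_deriv (g c) x B s = - \<tau> s *\<^sub>R N s))"

definition vortex_filament_solution ::
    "'m chart set \<Rightarrow> ('m chart \<Rightarrow> metric_coeffs) \<Rightarrow> real \<Rightarrow>
     (real \<Rightarrow> real \<Rightarrow> 'm) \<Rightarrow> (real \<Rightarrow> real \<Rightarrow> real) \<Rightarrow> bool"
  where "vortex_filament_solution atlas g \<epsilon> \<alpha> \<kappa> \<longleftrightarrow>
    (\<forall>t\<in>{-\<epsilon><..<\<epsilon>}. \<forall>s. \<forall>c\<in>atlas. \<alpha> t s \<in> fst c \<longrightarrow>
       vector_derivative (\<lambda>r. snd c (\<alpha> r s)) (at t) =
       \<kappa> t s *\<^sub>R binormal (g c) (snd c \<circ> \<alpha> t) s)"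

section \<open>The wave function\<close>

text \<open>The integral of \<open>\<tau>\<close> over the whole circle need not be a multiple of \<open>2\<pi>\<close>, so in general \<open>hasimoto\<close>
  is a function of the lifted parameter \<open>s\<close> in \<open>\<real>\<close> only.\<close>

definition hasimoto :: "(real \<Rightarrow> real \<Rightarrow> real) \<Rightarrow> (real \<Rightarrow> real \<Rightarrow> real) \<Rightarrow> real \<Rightarrow> real \<Rightarrow> complex"
  where "hasimoto \<kappa> \<tau> t s =
    complex_of_real (\<kappa> t s) * exp (\<i> * complex_of_real (LBINT x=0..s. \<tau> t x))"

definition hasimoto_potential :: "(real \<Rightarrow> real \<Rightarrow> real) \<Rightarrow> (real \<Rightarrow> real \<Rightarrow> real) \<Rightarrow> real \<Rightarrow> real"
  where "hasimoto_potential \<kappa> \<tau> t =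
    1 / \<kappa> t 0 * deriv (deriv (\<kappa> t)) 0 - (\<tau> t 0)\<^sup>2 + 1/2 * (\<kappa> t 0)\<^sup>2"

definition gauged_hasimoto ::
    "(real \<Rightarrow> real \<Rightarrow> real) \<Rightarrow> (real \<Rightarrow> real \<Rightarrow> real) \<Rightarrow> real \<Rightarrow> real \<Rightarrow> complex"
  where "gauged_hasimoto \<kappa> \<tau> t s =
    exp (\<i> * complex_of_real (LBINT x=0..t. hasimoto_potential \<kappa> \<tau> x)) * hasimoto \<kappa> \<tau> t s"

definition partial_t :: "(real \<Rightarrow> real \<Rightarrow> complex) \<Rightarrow> real \<Rightarrow> real \<Rightarrow> complex"
  where "partial_t \<psi> t s = vector_derivative (\<lambda>r. \<psi> r s) (at t)"

definition partial_s :: "(real \<Rightarrow> real \<Rightarrow> complex) \<Rightarrow> real \<Rightarrow> real \<Rightarrow> complex"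
  where "partial_s \<psi> t s = vector_derivative (\<psi> t) (at s)"

text \<open>\<open>vector_derivative\<close> is a total function, so existence of the derivatives entering the equations is
  recorded separately.\<close>

definition has_partials :: "(real \<Rightarrow> real \<Rightarrow> complex) \<Rightarrow> real \<Rightarrow> real \<Rightarrow> bool"
  where "has_partials \<psi> t s \<longleftrightarrow>
    (\<lambda>r. \<psi> r s) differentiable (at t) \<and>
    (\<forall>s'. \<psi> t differentiable (at s')) \<and>
    partial_s \<psi> t differentiable (at s)"

end

(*
  Along the vortex filament flow the velocity is kappa B, so D_t T = D_s (kappa B) is known.
  Commuting covariant derivatives, D_t D_s V - D_s D_t V = R(kappa B, T) V, for V = T and V = N
  and using constant curvature to evaluate the components <R(B,T)T,B> = K and
  <R(B,T)T,N> = <R(B,T)N,B> = 0 gives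
    kappa_t = - (2 kappa_s tau + kappa tau_s),
    tau_t = d/ds (kappa_ss / kappa - tau^2 + kappa^2 / 2),
  in which K no longer occurs. The second equation integrates to the time derivative of the phase,
  up to the value A(t) at s = 0, and the Schroedinger equation is then algebra.
*)

theory Submission
  imports Defs
begin

section \<open>Calculus of smooth maps\<close>

text \<open>The obstacle is regularity: \<open>has_curvature_torsion\<close> determines \<kappa> and
  \<tau> pointwise and for each t separately, while the argument differentiates them in t and s. So
  in each chart the frame is rebuilt from D_s T: N is its normalization, B the metric cross product
  of T and N, and then \<kappa> = <D_s T, N> and \<tau> = <D_s N, B> are smooth in (t, s). Being
  scalars, they glue over the charts. The fields T, N, B live only along the curves, so the
  covariant calculus is developed for vector fields along a map from a parameter space. The
  intermediate unknown is <D_t N, B>. The T commutator gives it as \<kappa>_ss / \<kappa> - \<tau>^2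
  + K; its s-derivative enters \<tau>_t, and this is where the constant K is lost. The other
  contribution to \<tau>_t is \<kappa> <D_t T, B> = \<kappa> \<kappa>_s, the s-derivative of
  \<kappa>^2 / 2. Hence \<tau>_t is a total s-derivative, and the phase evolves by a boundary
  difference. The boundary value at s = 0 depends on t alone, so a factor depending on t alone
  removes it.\<close>

lemma Ck_on_cong:
  assumes "open S" "Ck_on k S f" "\<And>x. x \<in> S \<Longrightarrow> f x = h x"
  shows "Ck_on k S h"
  using assms(2,3)
proof (induction k arbitrary: f h)
  case 0
  then show ?case
    using continuous_on_cong[of S S f h] by simp
next
  case (Suc k)
  have fr: "frechet_derivative f (at x) = frechet_derivative h (at x)" if "x \<in> S" for x
    using Suc.prems assms(1) that by (intro frechet_derivative_transform_within_open) auto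
  have "h differentiable (at x)" if "x \<in> S" for x
  proof -
    have "f differentiable (at x)" using Suc.prems(1) that by simp
    then obtain f' where "(f has_derivative f') (at x)" unfolding differentiable_def by blast
    then have "(h has_derivative f') (at x)"
      using has_derivative_transform_within_open[OF _ assms(1) that] Suc.prems(2) by blast
    then show ?thesis by (auto simp: differentiable_def)
  qed
  moreover have "Ck_on k S (\<lambda>x. frechet_derivative h (at x) v)" for v
    using Suc.IH[of "\<lambda>x. frechet_derivative f (at x) v" "\<lambda>x. frechet_derivative h (at x) v"]
      Suc.prems fr by auto
  ultimately show ?case by simp
qed

text \<open>The closure proofs produce an explicit derivative f', whereas \<open>Ck_on\<close>
  speaks of \<open>frechet_derivative\<close>. The two agree on S only, so the transfer goes through
  \<open>Ck_on_cong\<close>.\<close>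

lemma Ck_on_SucI:
  assumes "open S" "\<And>x. x \<in> S \<Longrightarrow> (f has_derivative f' x) (at x)"
    and "\<And>v. Ck_on k S (\<lambda>x. f' x v)"
  shows "Ck_on (Suc k) S f"
proof -
  have "frechet_derivative f (at x) = f' x" if "x \<in> S" for x
    using assms(2)[OF that] frechet_derivative_at by metis
  then have "Ck_on k S (\<lambda>x. frechet_derivative f (at x) v)" for v
    by (intro Ck_on_cong[OF assms(1) assms(3)[of v]]) auto
  then show ?thesis
    using assms(2) by (auto simp: differentiable_def)
qed

lemma Ck_on_SucD:
  assumes "Ck_on (Suc k) S f" "x \<in> S"
  shows "(f has_derivative frechet_derivative f (at x)) (at x)"
  using assms frechet_derivative_works by auto

lemma Ck_on_Suc_imp: "Ck_on (Suc k) S f \<Longrightarrow> Ck_on k S f"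
proof (induction k arbitrary: f)
  case 0
  then show ?case
    by (auto intro!: continuous_at_imp_continuous_on differentiable_imp_continuous_within)
next
  case (Suc k)
  then show ?case by (metis Ck_on.simps(2))
qed

lemma Ck_on_const: "Ck_on k S (\<lambda>x. c)"
  by (induction k arbitrary: c) auto

text \<open>Each clause of \<open>Ck_on\<close> concerns the behavior of f near single points of S.
  This is what later allows gluing over the preimages of charts.\<close>

lemma Ck_on_local:
  assumes "\<And>x. x \<in> S \<Longrightarrow> \<exists>V. open V \<and> x \<in> V \<and> Ck_on k V f"
  shows "Ck_on k S f"
  using assms
proof (induction k arbitrary: f)
  case 0
  show ?case
    unfolding Ck_on.simps
  proof (rule continuous_at_imp_continuous_on, rule ballI)
    fix x assume "x \<in> S"
    then obtain V where "open V" "x \<in> V" "Ck_on 0 V f" using 0 by blast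
    then show "isCont f x" by (simp add: continuous_on_eq_continuous_at)
  qed
next
  case (Suc k)
  have "f differentiable (at x)" if "x \<in> S" for x
    using Suc.prems[OF that] by auto
  moreover have "Ck_on k S (\<lambda>x. frechet_derivative f (at x) v)" for v
  proof (rule Suc.IH)
    fix x assume "x \<in> S"
    then obtain V where "open V" "x \<in> V" "Ck_on (Suc k) V f" using Suc.prems by blast
    then show "\<exists>V. open V \<and> x \<in> V \<and> Ck_on k V (\<lambda>x. frechet_derivative f (at x) v)" by auto
  qed
  ultimately show ?case by simp
qed

lemma Ck_on_add:
  assumes "open S"
  shows "Ck_on k S f \<Longrightarrow> Ck_on k S h \<Longrightarrow> Ck_on k S (\<lambda>x. f x + h x)"
proof (induction k arbitrary: f h)
  case 0
  then show ?case by (simp add: continuous_on_add)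
next
  case (Suc k)
  show ?case
    by (rule Ck_on_SucI[OF assms has_derivative_add])
      (use Suc in \<open>auto intro: Ck_on_SucD\<close>)
qed

lemma Ck_on_linear:
  assumes "open S" "bounded_linear F"
  shows "Ck_on k S f \<Longrightarrow> Ck_on k S (\<lambda>x. F (f x))"
proof (induction k arbitrary: f)
  case 0
  then show ?case
    using assms(2) bounded_linear.continuous_on by auto
next
  case (Suc k)
  show ?case
    by (rule Ck_on_SucI[OF assms(1) bounded_linear.has_derivative[OF assms(2)]])
      (use Suc in \<open>auto intro: Ck_on_SucD\<close>)
qed

text \<open>One Leibniz rule serves products, scalar multiples, inner products, the action of
  matrices and the cross product. In each summand of the derivative only one factor is
  differentiated, so the other one is needed at the lower order as well.\<close>

lemma Ck_on_bilinear:
  assumes "open S" "bounded_bilinear F"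
  shows "Ck_on k S f \<Longrightarrow> Ck_on k S h \<Longrightarrow> Ck_on k S (\<lambda>x. F (f x) (h x))"
proof (induction k arbitrary: f h)
  case 0
  then show ?case
    using assms(2) bounded_bilinear.continuous_on by auto
next
  case (Suc k)
  have "Ck_on k S f" "Ck_on k S h"
    using Suc.prems by (auto intro: Ck_on_Suc_imp)
  moreover have "Ck_on k S (\<lambda>x. frechet_derivative f (at x) v)"
    "Ck_on k S (\<lambda>x. frechet_derivative h (at x) v)" for v
    using Suc.prems by auto
  ultimately have "Ck_on k S (\<lambda>x. F (f x) (frechet_derivative h (at x) v)
      + F (frechet_derivative f (at x) v) (h x))" for v
    by (intro Ck_on_add[OF assms(1)] Suc.IH)
  then show ?case
    by (rule Ck_on_SucI[OF assms(1) bounded_bilinear.FDERIV[OF assms(2)], rotated -1])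
      (use Suc.prems in \<open>auto intro: Ck_on_SucD\<close>)
qed

lemma Ck_on_sum:
  assumes "open S" "\<And>i. i \<in> I \<Longrightarrow> Ck_on k S (f i)"
  shows "Ck_on k S (\<lambda>x. \<Sum>i\<in>I. f i x)"
  using assms(2)
  by (induction I rule: infinite_finite_induct)
    (auto intro!: Ck_on_const Ck_on_add[OF assms(1)])

text \<open>In the chain rule the derivative of h is taken in a direction that varies with x, so the
  induction hypothesis does not apply to it. Expanding that direction in the basis leaves
  derivatives of h in fixed directions, multiplied by scalar functions.\<close>

lemma Ck_on_compose:
  assumes "open S" "open V" "f ` S \<subseteq> V"
  shows "Ck_on k S f \<Longrightarrow> Ck_on k V h \<Longrightarrow> Ck_on k S (\<lambda>x. h (f x))"
proof (induction k arbitrary: h)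
  case 0
  then show ?case
    using assms(3) by (auto intro: continuous_on_compose2)
next
  case (Suc k)
  have df: "(f has_derivative frechet_derivative f (at x)) (at x)" if "x \<in> S" for x
    using Suc.prems that by (auto intro: Ck_on_SucD)
  have dh: "(h has_derivative frechet_derivative h (at (f x))) (at (f x))" if "x \<in> S" for x
    using Suc.prems that assms(3) by (intro Ck_on_SucD) auto
  have fk: "Ck_on k S f"
    using Suc.prems by (auto intro: Ck_on_Suc_imp)
  have "Ck_on k S (\<lambda>x. \<Sum>b\<in>Basis. (frechet_derivative f (at x) v \<bullet> b) *\<^sub>R
          frechet_derivative h (at (f x)) b)" for v
  proof (intro Ck_on_sum[OF assms(1)] Ck_on_bilinear[OF assms(1) bounded_bilinear_scaleR])
    fix b :: 'b
    show "Ck_on k S (\<lambda>x. frechet_derivative f (at x) v \<bullet> b)"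
      using Suc.prems by (intro Ck_on_linear[OF assms(1) bounded_linear_inner_left]) auto
    show "Ck_on k S (\<lambda>x. frechet_derivative h (at (f x)) b)"
      using Suc.IH[OF fk, of "\<lambda>y. frechet_derivative h (at y) b"] Suc.prems by auto
  qed
  moreover have "(\<Sum>b\<in>Basis. (frechet_derivative f (at x) v \<bullet> b) *\<^sub>R frechet_derivative h (at (f x)) b)
      = frechet_derivative h (at (f x)) (frechet_derivative f (at x) v)" if "x \<in> S" for x v
    using linear_sum[OF has_derivative_linear[OF dh[OF that]],
        of "\<lambda>b. (frechet_derivative f (at x) v \<bullet> b) *\<^sub>R b" Basis]
    by (simp add: euclidean_representation linear_scale[OF has_derivative_linear[OF dh[OF that]]])
  ultimately have *: "Ck_on k S (\<lambda>x. frechet_derivative h (at (f x)) (frechet_derivative f (at x) v))" for v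
    by (rule Ck_on_cong[OF assms(1)])
  show ?case
    by (rule Ck_on_SucI[OF assms(1) has_derivative_compose[OF df dh] *])
qed

text \<open>The derivative is a polynomial in the function itself, so each order of
  differentiability yields the next.\<close>

lemma Ck_on_inverse_real: "Ck_on k (- {0}) (inverse :: real \<Rightarrow> real)"
proof (induction k)
  case 0
  then show ?case by (auto intro!: continuous_intros)
next
  case (Suc k)
  have o: "open (- {0 :: real})" by auto
  have "Ck_on k (-{0}) (\<lambda>x::real. (- v) * (inverse x * inverse x))" for v
    using Suc
    by (intro Ck_on_bilinear[OF o bounded_bilinear_mult] Ck_on_const) auto
  then show ?case
    by (intro Ck_on_SucI[OF o, where f' = "\<lambda>x v. (- v) * (inverse x * inverse x)"])
      (auto intro!: derivative_eq_intros)
qed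

text \<open>The same bootstrap: the derivative is a multiple of the inverse of the function.\<close>

lemma Ck_on_sqrt: "Ck_on k {0<..} sqrt"
proof (induction k)
  case 0
  then show ?case by (auto intro!: continuous_intros)
next
  case (Suc k)
  have o: "open {0 :: real<..}" by auto
  have "Ck_on k {0<..} (\<lambda>x::real. (v / 2) * inverse (sqrt x))" for v
    using Suc
    by (intro Ck_on_bilinear[OF o bounded_bilinear_mult] Ck_on_const
        Ck_on_compose[OF o _ _ _ Ck_on_inverse_real]) auto
  then show ?case
    by (intro Ck_on_SucI[OF o, where f' = "\<lambda>x v. (v / 2) * inverse (sqrt x)"])
      (auto intro!: derivative_eq_intros simp: field_simps)
qed

section \<open>Closure properties of smooth maps\<close>

lemma smooth_on_cong:
  "open S \<Longrightarrow> smooth_on S f \<Longrightarrow> (\<And>x. x \<in> S \<Longrightarrow> f x = h x) \<Longrightarrow> smooth_on S h"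
  unfolding smooth_on_def using Ck_on_cong by blast

lemma smooth_on_local:
  "(\<And>x. x \<in> S \<Longrightarrow> \<exists>V. open V \<and> x \<in> V \<and> smooth_on V f) \<Longrightarrow> smooth_on S f"
  unfolding smooth_on_def by (meson Ck_on_local)

lemma smooth_on_const: "smooth_on S (\<lambda>x. c)"
  by (simp add: smooth_on_def Ck_on_const)

lemma smooth_on_linear: "open S \<Longrightarrow> bounded_linear F \<Longrightarrow> smooth_on S f \<Longrightarrow> smooth_on S (\<lambda>x. F (f x))"
  by (simp add: smooth_on_def Ck_on_linear)

lemma smooth_on_ident: "open S \<Longrightarrow> smooth_on S (\<lambda>x. x)"
  unfolding smooth_on_def
proof
  fix k assume "open S"
  then show "Ck_on k S (\<lambda>x. x)"
    by (cases k) (auto simp: Ck_on_const continuous_on_id)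
qed

lemma smooth_on_bilinear:
  "open S \<Longrightarrow> bounded_bilinear F \<Longrightarrow> smooth_on S f \<Longrightarrow> smooth_on S h \<Longrightarrow>
    smooth_on S (\<lambda>x. F (f x) (h x))"
  by (simp add: smooth_on_def Ck_on_bilinear)

lemma smooth_on_compose:
  "open S \<Longrightarrow> open V \<Longrightarrow> f ` S \<subseteq> V \<Longrightarrow> smooth_on S f \<Longrightarrow> smooth_on V h \<Longrightarrow>
    smooth_on S (\<lambda>x. h (f x))"
  unfolding smooth_on_def using Ck_on_compose by blast

lemma smooth_on_add: "open S \<Longrightarrow> smooth_on S f \<Longrightarrow> smooth_on S h \<Longrightarrow> smooth_on S (\<lambda>x. f x + h x)"
  by (simp add: smooth_on_def Ck_on_add)

lemma smooth_on_sum: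
  "open S \<Longrightarrow> (\<And>i. i \<in> I \<Longrightarrow> smooth_on S (f i)) \<Longrightarrow> smooth_on S (\<lambda>x. \<Sum>i\<in>I. f i x)"
  by (simp add: smooth_on_def Ck_on_sum)

lemma smooth_on_minus: "open S \<Longrightarrow> smooth_on S f \<Longrightarrow> smooth_on S (\<lambda>x. - f x)"
  by (rule smooth_on_linear[OF _ bounded_linear_minus[OF bounded_linear_ident]])

lemma smooth_on_diff: "open S \<Longrightarrow> smooth_on S f \<Longrightarrow> smooth_on S h \<Longrightarrow> smooth_on S (\<lambda>x. f x - h x)"
  using smooth_on_add[of S f "\<lambda>x. - h x"] smooth_on_minus[of S h] by simp

lemma smooth_on_vec_nth: "open S \<Longrightarrow> smooth_on S f \<Longrightarrow> smooth_on S (\<lambda>x. f x $ i)"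
  by (rule smooth_on_linear[OF _ bounded_linear_vec_nth])

lemma smooth_on_vec_lambda:
  fixes f :: "'a::euclidean_space \<Rightarrow> 'n::finite \<Rightarrow> 'b::euclidean_space"
  assumes "open S" "\<And>i. smooth_on S (\<lambda>x. f x i)"
  shows "smooth_on S (\<lambda>x. \<chi> i. f x i)"
proof -
  have lin: "bounded_linear (\<lambda>y::'b. axis i y :: 'b^'n)" for i
    by (rule linear_conv_bounded_linear[THEN iffD1]) (auto intro!: linearI simp: vec_eq_iff axis_def)
  have "(\<chi> i. f x i) = (\<Sum>i\<in>UNIV. axis i (f x i))" for x
    by (auto simp: vec_eq_iff axis_def sum.delta)
  then show ?thesis
    using assms by (auto intro!: smooth_on_sum smooth_on_linear[OF _ lin])
qed

lemmas smooth_on_mult = smooth_on_bilinear[OF _ bounded_bilinear_mult]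
lemmas smooth_on_scaleR = smooth_on_bilinear[OF _ bounded_bilinear_scaleR]
lemmas smooth_on_inner = smooth_on_bilinear[OF _ bounded_bilinear_inner]

lemma smooth_on_inverse:
  fixes f :: "'a::euclidean_space \<Rightarrow> real"
  assumes "open S" "smooth_on S f" "\<And>x. x \<in> S \<Longrightarrow> f x \<noteq> 0"
  shows "smooth_on S (\<lambda>x. inverse (f x))"
proof (rule smooth_on_compose[OF assms(1) _ _ assms(2)])
  show "smooth_on (- {0}) (inverse :: real \<Rightarrow> real)"
    by (simp add: smooth_on_def Ck_on_inverse_real)
qed (use assms(3) in auto)

lemma smooth_on_divide:
  fixes f :: "'a::euclidean_space \<Rightarrow> real"
  assumes "open S" "smooth_on S f" "smooth_on S h" "\<And>x. x \<in> S \<Longrightarrow> h x \<noteq> 0"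
  shows "smooth_on S (\<lambda>x. f x / h x)"
  unfolding divide_inverse by (intro smooth_on_mult smooth_on_inverse assms)

lemma smooth_on_sqrt:
  assumes "open S" "smooth_on S f" "\<And>x. x \<in> S \<Longrightarrow> 0 < f x"
  shows "smooth_on S (\<lambda>x. sqrt (f x))"
proof (rule smooth_on_compose[OF assms(1) _ _ assms(2)])
  show "smooth_on {0<..} sqrt"
    by (simp add: smooth_on_def Ck_on_sqrt)
qed (use assms(3) in auto)

lemma smooth_on_prod:
  fixes f :: "'i \<Rightarrow> 'a::euclidean_space \<Rightarrow> real"
  assumes "open S" "\<And>i. i \<in> I \<Longrightarrow> smooth_on S (f i)"
  shows "smooth_on S (\<lambda>x. \<Prod>i\<in>I. f i x)"
  using assms(2)
  by (induction I rule: infinite_finite_induct)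
    (auto intro!: smooth_on_const smooth_on_mult[OF assms(1)])

lemma smooth_on_det:
  fixes M :: "'a::euclidean_space \<Rightarrow> real^'n^'n"
  assumes "open S" "smooth_on S M"
  shows "smooth_on S (\<lambda>x. det (M x))"
  unfolding det_def
  by (intro smooth_on_sum smooth_on_mult smooth_on_const smooth_on_prod smooth_on_vec_nth assms)

lemma matrix_inv_mult:
  fixes A :: "real^'n^'n"
  assumes "invertible A"
  shows "A ** matrix_inv A = mat 1" "matrix_inv A ** A = mat 1"
  using someI_ex[OF assms[unfolded invertible_def]] unfolding matrix_inv_def by auto

text \<open>Cramer's rule exhibits the entries of the inverse as quotients of polynomials in the
  entries of A. Smoothness of the inverse metric rests on this.\<close>

lemma matrix_inv_cramer:
  fixes A :: "real^'n^'n"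
  assumes "det A \<noteq> 0"
  shows "matrix_inv A = (\<chi> k l. det (\<chi> i j. if j = k then (axis l 1 :: real^'n) $ i else A $ i $ j) / det A)"
proof -
  have "invertible A" using assms by (simp add: invertible_det_nz)
  then have "A *v (matrix_inv A *v axis l 1) = axis l 1" for l
    by (simp add: matrix_vector_mul_assoc matrix_inv_mult(1)[OF \<open>invertible A\<close>])
  then have *: "matrix_inv A *v axis l 1 =
      (\<chi> k. det (\<chi> i j. if j = k then (axis l 1 :: real^'n) $ i else A $ i $ j) / det A)" for l
    using cramer[OF assms] by blast
  have "matrix_inv A $ k $ l = (matrix_inv A *v axis l 1) $ k" for k l
    by (simp add: matrix_vector_mul_component inner_axis)
  then show ?thesis
    using * by (simp add: vec_eq_iff)
qed

lemma smooth_on_matrix_inv: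
  fixes M :: "'a::euclidean_space \<Rightarrow> real^'n^'n"
  assumes "open S" "smooth_on S M" "\<And>x. x \<in> S \<Longrightarrow> det (M x) \<noteq> 0"
  shows "smooth_on S (\<lambda>x. matrix_inv (M x))"
proof -
  have e: "smooth_on S (\<lambda>x. if j = k then c else M x $ i $ j)" for c i j and k :: 'n
    using smooth_on_const assms(1,2) by (cases "j = k") (auto intro!: smooth_on_vec_nth)
  have "smooth_on S (\<lambda>x. \<chi> k l.
      det (\<chi> i j. if j = k then (axis l 1 :: real^'n) $ i else M x $ i $ j) / det (M x))"
    by (intro smooth_on_vec_lambda smooth_on_divide smooth_on_det e assms)
  then show ?thesis
    by (rule smooth_on_cong[OF assms(1)]) (simp add: matrix_inv_cramer assms(3))
qed

lemmas smooth_intros = smooth_on_const smooth_on_ident smooth_on_add smooth_on_diff smooth_on_minus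
  smooth_on_sum smooth_on_mult smooth_on_scaleR smooth_on_inner smooth_on_vec_nth
  smooth_on_vec_lambda smooth_on_divide smooth_on_inverse smooth_on_sqrt

subsection \<open>Directional derivatives\<close>

text \<open>With the direction as first argument, \<open>dird e f\<close> is again a map, so that
  derivatives can be iterated.\<close>

definition dird :: "'a::real_normed_vector \<Rightarrow> ('a \<Rightarrow> 'b::real_normed_vector) \<Rightarrow> 'a \<Rightarrow> 'b"
  where "dird e f p = frechet_derivative f (at p) e"

lemma dird_eq: "(f has_derivative f') (at p) \<Longrightarrow> dird e f p = f' e"
  unfolding dird_def by (metis frechet_derivative_at)

lemma smooth_on_has_derivative:
  assumes "smooth_on S f" "x \<in> S"
  shows "(f has_derivative (\<lambda>e. dird e f x)) (at x)"
proof -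
  have "Ck_on (Suc 0) S f" using assms(1) unfolding smooth_on_def by blast
  then show ?thesis unfolding dird_def using Ck_on_SucD assms(2) by blast
qed

lemma smooth_on_continuous_on: "smooth_on S f \<Longrightarrow> continuous_on S f"
  unfolding smooth_on_def using Ck_on.simps(1) by blast

lemma smooth_on_dird: "smooth_on S f \<Longrightarrow> smooth_on S (dird e f)"
  unfolding smooth_on_def dird_def[abs_def]
proof
  fix k assume "\<forall>k. Ck_on k S f"
  then have "Ck_on (Suc k) S f" by blast
  then show "Ck_on k S (\<lambda>p. frechet_derivative f (at p) e)" by simp
qed

lemma dird_cong:
  assumes "open S" "smooth_on S f" "\<And>x. x \<in> S \<Longrightarrow> f x = h x" "p \<in> S"
  shows "dird e f p = dird e h p"
proof -
  have "(h has_derivative (\<lambda>e. dird e f p)) (at p)"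
    using has_derivative_transform_within_open[OF smooth_on_has_derivative[OF assms(2,4)] assms(1,4)] assms(3)
    by blast
  then show ?thesis by (simp add: dird_eq)
qed

lemma dird_bilinear:
  assumes "bounded_bilinear F" "smooth_on S f" "smooth_on S h" "p \<in> S"
  shows "dird e (\<lambda>x. F (f x) (h x)) p = F (f p) (dird e h p) + F (dird e f p) (h p)"
  by (rule dird_eq[OF bounded_bilinear.FDERIV[OF assms(1)]])
    (use assms in \<open>auto intro: smooth_on_has_derivative\<close>)

lemma dird_linear:
  assumes "bounded_linear F" "smooth_on S f" "p \<in> S"
  shows "dird e (\<lambda>x. F (f x)) p = F (dird e f p)"
  by (rule dird_eq[OF bounded_linear.has_derivative[OF assms(1)]])
    (use assms in \<open>auto intro: smooth_on_has_derivative\<close>)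

lemma dird_add:
  assumes "smooth_on S f" "smooth_on S h" "p \<in> S"
  shows "dird e (\<lambda>x. f x + h x) p = dird e f p + dird e h p"
  by (rule dird_eq[OF has_derivative_add]) (use assms in \<open>auto intro: smooth_on_has_derivative\<close>)

lemma dird_diff:
  assumes "smooth_on S f" "smooth_on S h" "p \<in> S"
  shows "dird e (\<lambda>x. f x - h x) p = dird e f p - dird e h p"
  by (rule dird_eq[OF has_derivative_diff]) (use assms in \<open>auto intro: smooth_on_has_derivative\<close>)

lemma dird_sum:
  assumes "\<And>i. i \<in> I \<Longrightarrow> smooth_on S (f i)" "p \<in> S"
  shows "dird e (\<lambda>x. \<Sum>i\<in>I. f i x) p = (\<Sum>i\<in>I. dird e (f i) p)"
  by (rule dird_eq[OF has_derivative_sum]) (use assms in \<open>auto intro: smooth_on_has_derivative\<close>)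

lemma dird_const [simp]: "dird e (\<lambda>x. c) p = 0"
  by (rule dird_eq[OF has_derivative_const])

lemmas dird_mult = dird_bilinear[OF bounded_bilinear_mult]
lemmas dird_scaleR = dird_bilinear[OF bounded_bilinear_scaleR]
lemmas dird_vec_nth = dird_linear[OF bounded_linear_vec_nth]

lemma dird_compose:
  assumes "smooth_on S f" "smooth_on V h" "p \<in> S" "f p \<in> V"
  shows "dird e (\<lambda>x. h (f x)) p = dird (dird e f p) h (f p)"
  by (rule dird_eq[OF has_derivative_compose]) (use assms in \<open>auto intro: smooth_on_has_derivative\<close>)

lemma linear_dird: "smooth_on S f \<Longrightarrow> p \<in> S \<Longrightarrow> linear (\<lambda>e. dird e f p)"
  by (rule has_derivative_linear[OF smooth_on_has_derivative])

lemma dird_vec_expand: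
  fixes f :: "real^'n \<Rightarrow> 'b::euclidean_space"
  assumes "smooth_on S f" "p \<in> S"
  shows "dird v f p = (\<Sum>i\<in>UNIV. v $ i *\<^sub>R dird (axis i 1) f p)"
proof -
  note lin = linear_dird[OF assms]
  have "v = (\<Sum>i\<in>UNIV. v $ i *\<^sub>R axis i 1)"
    using basis_expansion[of v] by (simp add: scalar_mult_eq_scaleR)
  then have "dird v f p = dird (\<Sum>i\<in>UNIV. v $ i *\<^sub>R axis i 1) f p" by simp
  also have "\<dots> = (\<Sum>i\<in>UNIV. v $ i *\<^sub>R dird (axis i 1) f p)"
    by (simp add: linear_sum[OF lin] linear_scale[OF lin])
  finally show ?thesis .
qed

lemma has_vector_derivative_line:
  assumes "smooth_on S f" "p + a *\<^sub>R u \<in> S"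
  shows "((\<lambda>a. f (p + a *\<^sub>R u)) has_vector_derivative dird u f (p + a *\<^sub>R u)) (at a)"
proof -
  have 1: "((\<lambda>a. p + a *\<^sub>R u) has_derivative (\<lambda>h. h *\<^sub>R u)) (at a)"
    by (auto intro!: derivative_eq_intros)
  have "((\<lambda>a. f (p + a *\<^sub>R u)) has_derivative (\<lambda>h. dird (h *\<^sub>R u) f (p + a *\<^sub>R u))) (at a)"
    by (rule has_derivative_compose[OF 1 smooth_on_has_derivative[OF assms]])
  moreover have "dird (h *\<^sub>R u) f (p + a *\<^sub>R u) = h *\<^sub>R dird u f (p + a *\<^sub>R u)" for h
    by (rule linear_scale[OF has_derivative_linear[OF smooth_on_has_derivative[OF assms]]])
  ultimately show ?thesis by (simp add: has_vector_derivative_def)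
qed

text \<open>Both mixed derivatives are limits of the second difference of \<open>f\<close> divided by \<open>h\<^sup>2\<close>.\<close>

lemma second_difference:
  fixes f :: "'a::euclidean_space \<Rightarrow> real"
  assumes f: "smooth_on S f" and S: "cball p (h * (norm u + norm v)) \<subseteq> S" and h: "0 < h"
  shows "\<exists>a b. 0 < a \<and> a < h \<and> 0 < b \<and> b < h \<and>
    f (p + h *\<^sub>R u + h *\<^sub>R v) - f (p + h *\<^sub>R u) - f (p + h *\<^sub>R v) + f p =
      h\<^sup>2 * dird v (dird u f) (p + a *\<^sub>R u + b *\<^sub>R v)"
proof -
  have inS: "p + a *\<^sub>R u + b *\<^sub>R v \<in> S" if "0 \<le> a" "a \<le> h" "0 \<le> b" "b \<le> h" for a b
  proof -
    have "norm (a *\<^sub>R u + b *\<^sub>R v) \<le> a * norm u + b * norm v"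
      using norm_triangle_ineq[of "a *\<^sub>R u" "b *\<^sub>R v"] that by simp
    also have "\<dots> \<le> h * (norm u + norm v)"
      using that by (auto simp: distrib_left intro!: add_mono mult_right_mono)
    finally have "p + a *\<^sub>R u + b *\<^sub>R v \<in> cball p (h * (norm u + norm v))"
      by (simp add: mem_cball dist_norm norm_minus_commute add.assoc del: add_uminus_conv_diff)
    then show ?thesis using S by blast
  qed
  \<comment> \<open>The second difference is the increment over [0, h] of \<phi>, which is itself an
    increment of f along v. The mean value theorem is applied to \<phi>, and then to
    \<open>dird u f\<close> along v.\<close>
  define \<phi> where "\<phi> a = f ((p + h *\<^sub>R v) + a *\<^sub>R u) - f (p + a *\<^sub>R u)" for a
  have "(\<phi> has_real_derivative dird u f ((p + h *\<^sub>R v) + a *\<^sub>R u) - dird u f (p + a *\<^sub>R u)) (at a)"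
    if "0 \<le> a" "a \<le> h" for a
    unfolding \<phi>_def[abs_def] has_real_derivative_iff_has_vector_derivative
    using inS[of a h] inS[of a 0] that h
    by (intro has_vector_derivative_diff has_vector_derivative_line[OF f]) (auto simp: algebra_simps)
  from MVT2[OF h this] obtain a where a: "0 < a" "a < h"
    and eq1: "\<phi> h - \<phi> 0 = h * (dird u f ((p + h *\<^sub>R v) + a *\<^sub>R u) - dird u f (p + a *\<^sub>R u))"
    by auto
  have "((\<lambda>b. dird u f ((p + a *\<^sub>R u) + b *\<^sub>R v)) has_real_derivative
      dird v (dird u f) ((p + a *\<^sub>R u) + b *\<^sub>R v)) (at b)" if "0 \<le> b" "b \<le> h" for b
    unfolding has_real_derivative_iff_has_vector_derivative
    using inS[of a b] that a by (intro has_vector_derivative_line[OF smooth_on_dird[OF f]]) auto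
  from MVT2[OF h this] obtain b where b: "0 < b" "b < h"
    and eq2: "dird u f ((p + a *\<^sub>R u) + h *\<^sub>R v) - dird u f ((p + a *\<^sub>R u) + 0 *\<^sub>R v)
      = h * dird v (dird u f) ((p + a *\<^sub>R u) + b *\<^sub>R v)"
    by auto
  have "f (p + h *\<^sub>R u + h *\<^sub>R v) - f (p + h *\<^sub>R u) - f (p + h *\<^sub>R v) + f p = \<phi> h - \<phi> 0"
    by (simp add: \<phi>_def algebra_simps)
  also have "\<dots> = h\<^sup>2 * dird v (dird u f) (p + a *\<^sub>R u + b *\<^sub>R v)"
    using eq1 eq2 by (simp add: algebra_simps power2_eq_square)
  finally show ?thesis using a b by blast
qed

lemma dird_commute_real:
  fixes f :: "'a::euclidean_space \<Rightarrow> real"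
  assumes S: "open S" and f: "smooth_on S f" and p: "p \<in> S"
  shows "dird v (dird u f) p = dird u (dird v f) p"
proof (rule ccontr)
  define P where "P = dird v (dird u f)"
  define Q where "Q = dird u (dird v f)"
  assume "dird v (dird u f) p \<noteq> dird u (dird v f) p"
  \<comment> \<open>Half the gap: two values within this distance of P p and Q p cannot
    coincide.\<close>
  then have e: "0 < \<bar>P p - Q p\<bar> / 2" (is "0 < ?e") by (simp add: P_def Q_def)
  have "isCont P p" "isCont Q p"
    using smooth_on_continuous_on[OF smooth_on_dird[OF smooth_on_dird[OF f]]] S p
    by (auto simp: P_def Q_def continuous_on_eq_continuous_at)
  then obtain d1 d2 where d: "0 < d1" "0 < d2"
    and P: "\<And>y. dist y p < d1 \<Longrightarrow> dist (P y) (P p) < ?e"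
    and Q: "\<And>y. dist y p < d2 \<Longrightarrow> dist (Q y) (Q p) < ?e"
    using e unfolding continuous_at_eps_delta by metis
  obtain d3 where d3: "0 < d3" "cball p d3 \<subseteq> S"
    using S p open_contains_cball by blast
  \<comment> \<open>The added 1 keeps n positive when u = v = 0 and makes h * (norm u + norm v)
    strictly smaller than h * n, as the strict bounds on distances require.\<close>
  define n where "n = norm u + norm v + 1"
  have n: "0 < n" unfolding n_def by (smt (verit) norm_ge_zero)
  define h where "h = min (min d1 d2) d3 / n"
  have h: "0 < h" and hn: "h * n \<le> d1" "h * n \<le> d2" "h * n \<le> d3"
    using d d3 n by (auto simp: h_def)
  have lt: "h * (norm u + norm v) < h * n" using h by (simp add: n_def)
  have sub: "cball p (h * (norm u + norm v)) \<subseteq> S"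
    using d3(2) lt hn(3) subset_cball[of "h * (norm u + norm v)" d3 p] by auto
  have close: "dist (p + a *\<^sub>R u + b *\<^sub>R v) p < h * n" if "0 < a" "a < h" "0 < b" "b < h" for a b
  proof -
    have "norm (a *\<^sub>R u + b *\<^sub>R v) \<le> a * norm u + b * norm v"
      using norm_triangle_ineq[of "a *\<^sub>R u" "b *\<^sub>R v"] that by simp
    also have "\<dots> \<le> h * (norm u + norm v)"
      using that by (auto simp: distrib_left intro!: add_mono mult_right_mono)
    finally show ?thesis using lt by (simp add: dist_norm add.assoc)
  qed
  obtain a b where ab: "0 < a" "a < h" "0 < b" "b < h"
    and 1: "f (p + h *\<^sub>R u + h *\<^sub>R v) - f (p + h *\<^sub>R u) - f (p + h *\<^sub>R v) + f p =
      h\<^sup>2 * P (p + a *\<^sub>R u + b *\<^sub>R v)"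
    using second_difference[OF f sub h] unfolding P_def by blast
  obtain a' b' where ab': "0 < a'" "a' < h" "0 < b'" "b' < h"
    and 2: "f (p + h *\<^sub>R v + h *\<^sub>R u) - f (p + h *\<^sub>R v) - f (p + h *\<^sub>R u) + f p =
      h\<^sup>2 * Q (p + a' *\<^sub>R v + b' *\<^sub>R u)"
    using second_difference[OF f, where p = p and h = h and u = v and v = u] sub h
    unfolding Q_def by (auto simp: add.commute)
  have "p + h *\<^sub>R u + h *\<^sub>R v = p + h *\<^sub>R v + h *\<^sub>R u" by simp
  then have eq: "P (p + a *\<^sub>R u + b *\<^sub>R v) = Q (p + b' *\<^sub>R u + a' *\<^sub>R v)"
    using 1 2 h by (simp add: algebra_simps)
  have "dist (P (p + a *\<^sub>R u + b *\<^sub>R v)) (P p) < ?e"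
    using P close[OF ab] hn by auto
  moreover have "dist (Q (p + b' *\<^sub>R u + a' *\<^sub>R v)) (Q p) < ?e"
    using Q close[OF ab'(3,4,1,2)] hn by auto
  ultimately show False unfolding eq dist_real_def by (simp add: abs_if split: if_splits)
qed

text \<open>The mean value theorem is available for real values only, hence the reduction to
  components.\<close>

lemma dird_commute:
  fixes f :: "'a::euclidean_space \<Rightarrow> 'b::euclidean_space"
  assumes S: "open S" and f: "smooth_on S f" and p: "p \<in> S"
  shows "dird v (dird u f) p = dird u (dird v f) p"
proof (rule euclidean_eqI)
  fix b :: 'b
  have fb: "smooth_on S (\<lambda>x. f x \<bullet> b)"
    by (rule smooth_on_linear[OF S bounded_linear_inner_left f])
  have 1: "dird u (\<lambda>x. f x \<bullet> b) x = dird u f x \<bullet> b" if "x \<in> S" for u x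
    by (rule dird_linear[OF bounded_linear_inner_left f that])
  have 2: "dird v (dird u (\<lambda>x. f x \<bullet> b)) p = dird v (dird u f) p \<bullet> b" for u v
    by (rule trans[OF dird_cong[OF S smooth_on_dird[OF fb] 1 p]
          dird_linear[OF bounded_linear_inner_left smooth_on_dird[OF f] p]])
  show "dird v (dird u f) p \<bullet> b = dird u (dird v f) p \<bullet> b"
    using 2 dird_commute_real[OF S fb p] by metis
qed

section \<open>Curvature in a coordinate domain\<close>

lemma matrix_vector_mult_minus: "A *v (- v) = - (A *v v)" for A :: "real^'n^'m"
  using linear_neg[OF matrix_vector_mul_linear[of A]] .

lemma metric_inner_bilinear:
  "metric_inner G x (u + v) w = metric_inner G x u w + metric_inner G x v w"
  "metric_inner G x w (u + v) = metric_inner G x w u + metric_inner G x w v"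
  "metric_inner G x (u - v) w = metric_inner G x u w - metric_inner G x v w"
  "metric_inner G x w (u - v) = metric_inner G x w u - metric_inner G x w v"
  "metric_inner G x (a *\<^sub>R u) w = a * metric_inner G x u w"
  "metric_inner G x w (a *\<^sub>R u) = a * metric_inner G x w u"
  "metric_inner G x (- u) w = - metric_inner G x u w"
  "metric_inner G x w (- u) = - metric_inner G x w u"
  "metric_inner G x 0 w = 0"
  "metric_inner G x w 0 = 0"
  by (simp_all add: metric_inner_def inner_add_left inner_add_right inner_diff_left
      inner_diff_right matrix_vector_right_distrib matrix_vector_mult_diff_distrib
      matrix_vector_mult_scaleR matrix_vector_mult_minus)

text \<open>Sylvester's criterion by test vectors. The last columns of the adjugates of the leading
  1x1, 2x2 and 3x3 blocks, padded with zeros, give the form the values a, a times the second minor,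
  and the second minor times \<open>det M\<close>.\<close>

lemma det_pos_of_positive_definite:
  fixes M :: "real^3^3"
  assumes sym: "transpose M = M" and pos: "\<And>v. v \<noteq> 0 \<Longrightarrow> 0 < v \<bullet> (M *v v)"
  shows "0 < det M"
proof -
  have s: "M $ 2 $ 1 = M $ 1 $ 2" "M $ 3 $ 1 = M $ 1 $ 3" "M $ 3 $ 2 = M $ 2 $ 3"
    using arg_cong[OF sym, of "\<lambda>A. A $ 1 $ 2"] arg_cong[OF sym, of "\<lambda>A. A $ 1 $ 3"]
      arg_cong[OF sym, of "\<lambda>A. A $ 2 $ 3"] by (simp_all add: transpose_def)
  define a b c d e f where abc: "a = M $ 1 $ 1" "b = M $ 1 $ 2" "c = M $ 1 $ 3" "d = M $ 2 $ 2"
    "e = M $ 2 $ 3" "f = M $ 3 $ 3"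
  have q: "vector [x, y, z] \<bullet> (M *v vector [x, y, z]) =
      a * x\<^sup>2 + d * y\<^sup>2 + f * z\<^sup>2 + 2 * b * x * y + 2 * c * x * z + 2 * e * y * z" for x y z
    by (simp add: inner_vec_def matrix_vector_mult_def sum_3 abc s power2_eq_square algebra_simps)
  have nz: "(vector [x, y, z] :: real^3) \<noteq> 0" if "x \<noteq> 0 \<or> y \<noteq> 0 \<or> z \<noteq> 0" for x y z
    using that by (auto simp: vec_eq_iff forall_3)
  have "0 < a" using pos[OF nz[of 1 0 0]] by (simp add: q)
  moreover have "0 < a * (a * d - b\<^sup>2)"
    using pos[OF nz[of "- b" a 0]] \<open>0 < a\<close> by (simp add: q power2_eq_square algebra_simps)
  ultimately have minor: "0 < a * d - b\<^sup>2" by (simp add: zero_less_mult_iff)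
  have det: "det M = a * d * f + 2 * b * c * e - a * e\<^sup>2 - d * c\<^sup>2 - f * b\<^sup>2"
    by (simp add: det_3 abc s power2_eq_square algebra_simps)
  have "0 < (a * d - b\<^sup>2) * det M"
    using pos[OF nz[of "b * e - c * d" "b * c - a * e" "a * d - b\<^sup>2"]] minor
    by (simp add: q det power2_eq_square algebra_simps)
  then show ?thesis using minor by (simp add: zero_less_mult_iff)
qed

text \<open>The connection as a vector-valued bilinear form: in coordinates the covariant derivative
  is the ordinary one plus this term.\<close>

definition chr :: "metric_coeffs \<Rightarrow> real^3 \<Rightarrow> real^3 \<Rightarrow> real^3 \<Rightarrow> real^3"
  where "chr G x u v = (\<chi> k. \<Sum>i\<in>UNIV. \<Sum>j\<in>UNIV. christoffel G k i j x * u $ i * v $ j)"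

text \<open>The derivative of \<open>chr\<close> with respect to the base point in direction e, with
  u and v held fixed.\<close>

definition dchr :: "metric_coeffs \<Rightarrow> real^3 \<Rightarrow> real^3 \<Rightarrow> real^3 \<Rightarrow> real^3 \<Rightarrow> real^3"
  where "dchr G x e u v =
    (\<chi> k. \<Sum>i\<in>UNIV. \<Sum>j\<in>UNIV. dird e (christoffel G k i j) x * u $ i * v $ j)"

lemma partial_eq_dird: "partial i f x = dird (axis i 1) f x"
  by (simp add: partial_def dird_def)

lemma chr_bilinear:
  "chr G x (u + v) w = chr G x u w + chr G x v w"
  "chr G x w (u + v) = chr G x w u + chr G x w v"
  "chr G x (u - v) w = chr G x u w - chr G x v w"
  "chr G x w (u - v) = chr G x w u - chr G x w v"
  "chr G x (a *\<^sub>R u) w = a *\<^sub>R chr G x u w"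
  "chr G x w (a *\<^sub>R u) = a *\<^sub>R chr G x w u"
  by (simp_all add: chr_def vec_eq_iff sum_3 algebra_simps)

section \<open>The Levi-Civita connection and the curvature tensor of a metric in
  coordinates\<close>

locale riemannian_domain =
  fixes \<Omega> :: "(real^3) set" and G :: metric_coeffs
  assumes open_domain: "open \<Omega>"
    and smooth: "smooth_on \<Omega> G"
    and symmetric: "\<And>x. x \<in> \<Omega> \<Longrightarrow> transpose (G x) = G x"
    and positive: "\<And>x v. x \<in> \<Omega> \<Longrightarrow> v \<noteq> 0 \<Longrightarrow> 0 < metric_inner G x v v"
begin

lemma G_sym: "x \<in> \<Omega> \<Longrightarrow> G x $ i $ j = G x $ j $ i"
  using arg_cong[OF symmetric[of x], of "\<lambda>A. A $ i $ j"] by (simp add: transpose_def)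

lemma inner_sym: "x \<in> \<Omega> \<Longrightarrow> metric_inner G x u v = metric_inner G x v u"
  unfolding metric_inner_def
  by (metis dot_lmul_matrix inner_commute symmetric transpose_matrix_vector)

lemma det_pos: "x \<in> \<Omega> \<Longrightarrow> 0 < det (G x)"
  using det_pos_of_positive_definite[OF symmetric] positive by (auto simp: metric_inner_def)

lemma inv_right: "x \<in> \<Omega> \<Longrightarrow> G x *v (matrix_inv (G x) *v v) = v"
  using det_pos[of x] by (simp add: matrix_vector_mul_assoc matrix_inv_mult invertible_det_nz)

lemma inv_left: "x \<in> \<Omega> \<Longrightarrow> matrix_inv (G x) *v (G x *v v) = v"
  using det_pos[of x] by (simp add: matrix_vector_mul_assoc matrix_inv_mult invertible_det_nz)

lemma smooth_component: "smooth_on \<Omega> (\<lambda>y. G y $ i $ j)"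
  by (intro smooth_on_vec_nth open_domain smooth)

lemma smooth_partial: "smooth_on \<Omega> f \<Longrightarrow> smooth_on \<Omega> (partial i f)"
  using smooth_on_dird[of \<Omega> f "axis i 1"] by (simp add: partial_eq_dird[abs_def])

lemma smooth_christoffel: "smooth_on \<Omega> (christoffel G k i j)"
  unfolding christoffel_def[abs_def]
  using det_pos
  by (intro smooth_intros smooth_on_matrix_inv smooth_partial open_domain smooth smooth_component) force

lemma christoffel_sym: "x \<in> \<Omega> \<Longrightarrow> christoffel G k i j x = christoffel G k j i x"
proof -
  assume x: "x \<in> \<Omega>"
  have "partial l (\<lambda>y. G y $ i $ j) x = partial l (\<lambda>y. G y $ j $ i) x" for l
    unfolding partial_eq_dird
    by (rule dird_cong[OF open_domain smooth_component G_sym x])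
  then show ?thesis by (simp add: christoffel_def add.commute)
qed

lemma chr_sym: "x \<in> \<Omega> \<Longrightarrow> chr G x u v = chr G x v u"
  unfolding chr_def
  by (subst sum.swap) (simp add: christoffel_sym[of x] mult.commute mult.left_commute)

lemma dchr_sym: "x \<in> \<Omega> \<Longrightarrow> dchr G x e u v = dchr G x e v u"
proof -
  assume x: "x \<in> \<Omega>"
  have "dird e (christoffel G k i j) x = dird e (christoffel G k j i) x" for k i j
    by (rule dird_cong[OF open_domain smooth_christoffel christoffel_sym x])
  then show ?thesis
    unfolding dchr_def by (subst sum.swap) (simp add: mult.commute mult.left_commute)
qed

text \<open>Lowering the index cancels the inverse metric and leaves the Christoffel symbols of the
  first kind.\<close>

lemma lower_chr:
  assumes x: "x \<in> \<Omega>"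
  shows "(G x *v chr G x u v) $ l = (\<Sum>i\<in>UNIV. \<Sum>j\<in>UNIV.
    (1/2) * (partial i (\<lambda>y. G y $ j $ l) x + partial j (\<lambda>y. G y $ i $ l) x
       - partial l (\<lambda>y. G y $ i $ j) x) * u $ i * v $ j)"
proof -
  define c where "c l = (\<Sum>i\<in>UNIV. \<Sum>j\<in>UNIV.
    (1/2) * (partial i (\<lambda>y. G y $ j $ l) x + partial j (\<lambda>y. G y $ i $ l) x
       - partial l (\<lambda>y. G y $ i $ j) x) * u $ i * v $ j)" for l
  have "chr G x u v = matrix_inv (G x) *v (\<chi> l. c l)"
    by (simp add: chr_def c_def vec_eq_iff christoffel_def matrix_vector_mult_def sum_3 algebra_simps
        add_divide_distrib diff_divide_distrib)
  then have "G x *v chr G x u v = (\<chi> l. c l)"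
    by (simp add: inv_right x)
  then show ?thesis by (simp add: c_def)
qed

text \<open>Metric compatibility of the connection. Of the six first-kind terms on the right, four
  cancel in pairs by symmetry of G, and the other two are the two halves of the left side.\<close>

lemma dird_metric_compatible:
  assumes x: "x \<in> \<Omega>"
  shows "v \<bullet> (dird u G x *v w) = metric_inner G x (chr G x u v) w + metric_inner G x v (chr G x u w)"
proof -
  have *: "partial i (\<lambda>y. G y $ j $ l) x = dird (axis i 1) G x $ j $ l" for i j l
    by (simp add: partial_eq_dird dird_vec_nth[OF smooth_on_vec_nth[OF open_domain smooth] x]
        dird_vec_nth[OF smooth x])
  have sym: "dird (axis i 1) G x $ j $ l = dird (axis i 1) G x $ l $ j" for i j l
    unfolding *[symmetric] partial_eq_dird
    by (rule dird_cong[OF open_domain smooth_component G_sym x])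
  have "metric_inner G x (chr G x u v) w + metric_inner G x v (chr G x u w) =
      w \<bullet> (G x *v chr G x u v) + v \<bullet> (G x *v chr G x u w)"
    using inner_sym[OF x] by (simp add: metric_inner_def)
  also have "\<dots> = v \<bullet> (dird u G x *v w)"
  proof -
    have low: "a \<bullet> (G x *v chr G x u b) = (\<Sum>l\<in>UNIV. a $ l * (\<Sum>i\<in>UNIV. \<Sum>j\<in>UNIV.
        (1/2) * (dird (axis i 1) G x $ j $ l + dird (axis j 1) G x $ i $ l
          - dird (axis l 1) G x $ i $ j) * u $ i * b $ j))" for a b
      by (simp add: inner_vec_def lower_chr[OF x] *)
    show ?thesis
      unfolding low unfolding dird_vec_expand[OF smooth x, of u] inner_vec_def matrix_vector_mult_def
      by (simp add: sum_3 sym[of _ 2 1] sym[of _ 3 1] sym[of _ 3 2]) (simp add: field_simps)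
  qed
  finally show ?thesis by simp
qed

text \<open>Frees the curvature from indices: skew symmetry in the first pair, the Bianchi identity
  and the commutator formula are all read off from this expression.\<close>

lemma riemann_eq:
  assumes x: "x \<in> \<Omega>"
  shows "riemann G x u v w = dchr G x u v w - dchr G x v u w
    + chr G x u (chr G x v w) - chr G x v (chr G x u w)"
proof -
  define C where "C k i j = christoffel G k i j x" for k i j
  define D where "D e k i j = dird (axis e 1) (christoffel G k i j) x" for e k i j
  have d: "dird e (christoffel G k i j) x = (\<Sum>m\<in>UNIV. e $ m * D m k i j)" for e k i j
    by (rule trans[OF dird_vec_expand[OF smooth_christoffel x]]) (simp add: D_def)
  have 1: "(\<Sum>i\<in>UNIV. \<Sum>j\<in>UNIV. \<Sum>k\<in>UNIV. D i l j k * u $ i * v $ j * w $ k) = dchr G x u v w $ l"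
    for u v w :: "real^3" and l
    by (simp add: dchr_def d sum_3) (simp add: algebra_simps)
  have 2: "(\<Sum>i\<in>UNIV. \<Sum>j\<in>UNIV. \<Sum>k\<in>UNIV. (\<Sum>m\<in>UNIV. C l i m * C m j k) * u $ i * v $ j * w $ k)
      = chr G x u (chr G x v w) $ l" for u v w :: "real^3" and l
    by (simp add: chr_def C_def[symmetric] sum_3) (simp add: algebra_simps)
  have swap: "(\<Sum>i\<in>UNIV. \<Sum>j\<in>UNIV. \<Sum>k\<in>UNIV. a j i k * u $ i * v $ j * w $ k)
      = (\<Sum>j\<in>UNIV. \<Sum>i\<in>UNIV. \<Sum>k\<in>UNIV. a j i k * v $ j * u $ i * w $ k)"
    for a :: "3 \<Rightarrow> 3 \<Rightarrow> 3 \<Rightarrow> real"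
    by (subst sum.swap) (simp add: mult.commute mult.left_commute)
  have "riemann G x u v w $ l = (\<Sum>i\<in>UNIV. \<Sum>j\<in>UNIV. \<Sum>k\<in>UNIV.
      D i l j k * u $ i * v $ j * w $ k - D j l i k * u $ i * v $ j * w $ k
      + (\<Sum>m\<in>UNIV. C l i m * C m j k) * u $ i * v $ j * w $ k
      - (\<Sum>m\<in>UNIV. C l j m * C m i k) * u $ i * v $ j * w $ k)" for l
    by (simp add: riemann_def riemann_coeff_def partial_eq_dird C_def[symmetric] D_def[symmetric]
        sum_subtractf left_diff_distrib distrib_right add_diff_eq)
  also have "\<dots> l = dchr G x u v w $ l - dchr G x v u w $ l
      + chr G x u (chr G x v w) $ l - chr G x v (chr G x u w) $ l" for l
    unfolding sum.distrib sum_subtractf 1 2 swap[of "\<lambda>j i k. D j l i k"]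
      swap[of "\<lambda>j i k. \<Sum>m\<in>UNIV. C l j m * C m i k"] ..
  finally show ?thesis by (simp add: vec_eq_iff)
qed

subsection \<open>Vector fields along a map\<close>

text \<open>The pulled-back connection: the base point moves with velocity \<open>dird e y p\<close>
  when the parameter moves in the constant direction e. It is used both for the affine surfaces in
  \<open>riemann_skew_34\<close> and for the (t, s) family of curves.\<close>

definition cov :: "('a::euclidean_space \<Rightarrow> real^3) \<Rightarrow> 'a \<Rightarrow> ('a \<Rightarrow> real^3) \<Rightarrow> 'a \<Rightarrow> real^3"
  where "cov y e V p = dird e V p + chr G (y p) (dird e y p) (V p)"

end

locale map_into_domain = riemannian_domain +
  fixes U :: "'a::euclidean_space set" and y :: "'a \<Rightarrow> real^3"
  assumes open_U: "open U" and smooth_y: "smooth_on U y" and into: "\<And>p. p \<in> U \<Longrightarrow> y p \<in> \<Omega>"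
begin

abbreviation ip :: "('a \<Rightarrow> real^3) \<Rightarrow> ('a \<Rightarrow> real^3) \<Rightarrow> 'a \<Rightarrow> real"
  where "ip V W p \<equiv> metric_inner G (y p) (V p) (W p)"

lemma smooth_along: "smooth_on \<Omega> f \<Longrightarrow> smooth_on U (\<lambda>p. f (y p))"
  by (rule smooth_on_compose[OF open_U open_domain _ smooth_y]) (use into in auto)

lemma smooth_chr:
  assumes "smooth_on U V" "smooth_on U W"
  shows "smooth_on U (\<lambda>p. chr G (y p) (V p) (W p))"
  unfolding chr_def by (intro smooth_intros smooth_along smooth_christoffel open_U assms)

lemma smooth_cov: "smooth_on U V \<Longrightarrow> smooth_on U (cov y e V)"
  unfolding cov_def[abs_def] by (intro smooth_intros smooth_chr smooth_on_dird open_U smooth_y)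

lemma metric_inner_sum:
  "metric_inner G x v w = (\<Sum>i\<in>UNIV. \<Sum>j\<in>UNIV. v $ i * G x $ i $ j * w $ j)"
  by (simp add: metric_inner_def inner_vec_def matrix_vector_mult_def sum_distrib_left mult.assoc)

lemma smooth_ip: "smooth_on U V \<Longrightarrow> smooth_on U W \<Longrightarrow> smooth_on U (ip V W)"
  unfolding metric_inner_sum
  by (intro smooth_intros smooth_along smooth open_U)

lemma cov_diff:
  assumes "smooth_on U V" "smooth_on U W" "p \<in> U"
  shows "cov y e (\<lambda>p. V p - W p) p = cov y e V p - cov y e W p"
  by (simp add: cov_def dird_diff[OF assms] chr_bilinear)

lemma cov_scaleR:
  assumes "smooth_on U f" "smooth_on U V" "p \<in> U"
  shows "cov y e (\<lambda>p. f p *\<^sub>R V p) p = dird e f p *\<^sub>R V p + f p *\<^sub>R cov y e V p"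
  by (simp add: cov_def dird_scaleR[OF assms] chr_bilinear algebra_simps)

lemma cov_cong:
  assumes "smooth_on U V" "\<And>p. p \<in> U \<Longrightarrow> V p = W p" "p \<in> U"
  shows "cov y e V p = cov y e W p"
  using dird_cong[OF open_U assms] assms by (simp add: cov_def)

text \<open>Both summands of \<open>cov\<close> are symmetric in d and e: the second derivatives
  commute and \<open>chr\<close> is symmetric. This turns D_t of the tangent into D_s of the flow
  velocity.\<close>

lemma cov_torsion_free: "p \<in> U \<Longrightarrow> cov y d (dird e y) p = cov y e (dird d y) p"
  using dird_commute[OF open_U smooth_y] chr_sym[OF into] by (simp add: cov_def)

lemma dird_along:
  assumes "smooth_on \<Omega> f" "p \<in> U"
  shows "dird e (\<lambda>p. f (y p)) p = dird (dird e y p) f (y p)"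
  using dird_compose[OF smooth_y assms(1) assms(2) into[OF assms(2)]] .

text \<open>The coefficients of G vary along the map; \<open>dird_metric_compatible\<close> trades
  their derivative for exactly the two connection terms that complete the ordinary derivatives to
  covariant ones.\<close>

lemma dird_ip:
  assumes V: "smooth_on U V" and W: "smooth_on U W" and p: "p \<in> U"
  shows "dird e (ip V W) p = ip (cov y e V) W p + ip V (cov y e W) p"
proof -
  have bb: "bounded_bilinear (\<lambda>(A :: real^3^3) v. A *v v)"
    by (rule bilinear_conv_bounded_bilinear[THEN iffD1])
      (auto simp: bilinear_def matrix_vector_mult_add_rdistrib matrix_vector_right_distrib
        matrix_vector_mult_scaleR scaleR_matrix_vector_assoc[symmetric] intro!: linearI)
  have GW: "smooth_on U (\<lambda>p. G (y p) *v W p)"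
    by (intro smooth_on_bilinear[OF open_U bb] smooth_along smooth W)
  have "dird e (ip V W) p = V p \<bullet> (G (y p) *v dird e W p + dird (dird e y p) G (y p) *v W p)
      + dird e V p \<bullet> (G (y p) *v W p)"
    unfolding metric_inner_def
    using dird_bilinear[OF bounded_bilinear_inner V GW p]
      dird_bilinear[OF bb smooth_along[OF smooth] W p] dird_along[OF smooth p] by simp
  then show ?thesis
    using dird_metric_compatible[OF into[OF p], of "V p" "dird e y p" "W p"]
    by (simp add: cov_def metric_inner_bilinear inner_add_right) (simp add: metric_inner_def)
qed

lemma dird_chr:
  assumes V: "smooth_on U V" and W: "smooth_on U W" and p: "p \<in> U"
  shows "dird e (\<lambda>p. chr G (y p) (V p) (W p)) p = dchr G (y p) (dird e y p) (V p) (W p)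
    + chr G (y p) (dird e V p) (W p) + chr G (y p) (V p) (dird e W p)"
proof -
  have c: "smooth_on U (\<lambda>p. christoffel G k i j (y p))" for k i j
    by (intro smooth_along smooth_christoffel)
  have Vi: "smooth_on U (\<lambda>p. V p $ i)" and Wi: "smooth_on U (\<lambda>p. W p $ i)" for i
    by (intro smooth_on_vec_nth open_U V W)+
  have "dird e (\<lambda>p. christoffel G k i j (y p) * V p $ i * W p $ j) p =
      dird (dird e y p) (christoffel G k i j) (y p) * V p $ i * W p $ j
      + christoffel G k i j (y p) * dird e V p $ i * W p $ j
      + christoffel G k i j (y p) * V p $ i * dird e W p $ j" for k i j
    by (simp add: dird_mult[OF smooth_on_mult[OF open_U c Vi] Wi p] dird_mult[OF c Vi p]
        dird_vec_nth[OF V p] dird_vec_nth[OF W p] dird_along[OF smooth_christoffel p])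
      (simp add: algebra_simps)
  then have "dird e (\<lambda>p. chr G (y p) (V p) (W p) $ k) p = (dchr G (y p) (dird e y p) (V p) (W p)
    + chr G (y p) (dird e V p) (W p) + chr G (y p) (V p) (dird e W p)) $ k" for k
    by (simp add: chr_def dchr_def dird_sum[OF _ p] smooth_on_sum smooth_on_mult[OF open_U] open_U
        c Vi Wi sum.distrib)
  then show ?thesis
    using dird_vec_nth[OF smooth_chr[OF V W] p] by (simp add: vec_eq_iff)
qed

text \<open>In the difference the second derivatives of V and of y cancel by
  \<open>dird_commute\<close>, and so do the terms with one derivative of V. What remains is the
  expression in \<open>riemann_eq\<close>; there is no bracket term because d and e are constant
  directions.\<close>

lemma cov_commute:
  assumes V: "smooth_on U V" and p: "p \<in> U"
  shows "cov y d (cov y e V) p - cov y e (cov y d V) p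
    = riemann G (y p) (dird d y p) (dird e y p) (V p)"
proof -
  have *: "dird d (cov y e V) p = dird d (dird e V) p + (dchr G (y p) (dird d y p) (dird e y p) (V p)
    + chr G (y p) (dird d (dird e y) p) (V p) + chr G (y p) (dird e y p) (dird d V p))" for d e
    unfolding cov_def[abs_def]
    by (simp add: dird_add[OF smooth_on_dird[OF V] smooth_chr[OF smooth_on_dird[OF smooth_y] V] p]
        dird_chr[OF smooth_on_dird[OF smooth_y] V p])
  show ?thesis
    unfolding cov_def[of y d "cov y e V"] cov_def[of y e "cov y d V"] * riemann_eq[OF into[OF p]]
    using dird_commute[OF open_U V p, of d e] dird_commute[OF open_U smooth_y p, of d e]
    by (simp add: cov_def chr_bilinear)
qed

end

context riemannian_domain
begin

subsection \<open>Symmetries of the curvature tensor\<close>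

lemma riemann_skew_12: "x \<in> \<Omega> \<Longrightarrow> riemann G x v u w = - riemann G x u v w"
  by (simp add: riemann_eq)

lemma riemann_bianchi:
  "x \<in> \<Omega> \<Longrightarrow> riemann G x u v w + riemann G x v w u + riemann G x w u v = 0"
  by (simp add: riemann_eq chr_sym[of x v u] chr_sym[of x w u] chr_sym[of x w v]
      dchr_sym[of x u w v] dchr_sym[of x v w u] dchr_sym[of x w v u])

text \<open>On the affine surface spanned by \<open>u\<close> and \<open>v\<close>, the curvature operator is the commutator of
  covariant derivatives; it is skew because the second derivatives of inner products commute.\<close>

lemma riemann_skew_34:
  assumes x: "x \<in> \<Omega>"
  shows "metric_inner G x (riemann G x u v w) z = - metric_inner G x w (riemann G x u v z)"
proof -
  define y where "y p = x + fst p *\<^sub>R u + snd p *\<^sub>R v" for p :: "real \<times> real"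
  have yd: "(y has_derivative (\<lambda>e. fst e *\<^sub>R u + snd e *\<^sub>R v)) (at p)" for p
    unfolding y_def[abs_def] by (auto intro!: derivative_eq_intros)
  have y_eq: "dird e y p = fst e *\<^sub>R u + snd e *\<^sub>R v" for e p by (rule dird_eq[OF yd])
  have "continuous_on UNIV y" unfolding y_def[abs_def] by (intro continuous_intros)
  then have o: "open (y -` \<Omega>)" using open_domain open_vimage by blast
  have sm: "smooth_on (y -` \<Omega>) y"
    unfolding y_def[abs_def]
    by (intro smooth_intros smooth_on_linear[OF _ bounded_linear_fst] smooth_on_linear[OF _ bounded_linear_snd])
      (use o in \<open>simp_all add: y_def[abs_def]\<close>)
  interpret map_into_domain \<Omega> G "y -` \<Omega>" y
    by unfold_locales (use o sm in auto)
  \<comment> \<open>Fields with constant coordinates along the surface suffice, since the curvature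
    at x depends only on their values there.\<close>
  define W Z where "W = (\<lambda>p :: real \<times> real. w)" and "Z = (\<lambda>p :: real \<times> real. z)"
  have W: "smooth_on (y -` \<Omega>) W" and Z: "smooth_on (y -` \<Omega>) Z"
    by (simp_all add: W_def Z_def smooth_on_const)
  have p: "0 \<in> y -` \<Omega>" and y0: "y 0 = x" using x by (simp_all add: y_def)
  define d e :: "real \<times> real" where "d = (1, 0)" and "e = (0, 1)"
  \<comment> \<open>The two terms with one derivative on each field are interchanged by swapping a
    and b, so they drop out of the commutator.\<close>
  have 2: "dird a (dird b (ip W Z)) 0 = ip (cov y a (cov y b W)) Z 0 + ip (cov y b W) (cov y a Z) 0
    + ip (cov y a W) (cov y b Z) 0 + ip W (cov y a (cov y b Z)) 0" for a b
    by (subst dird_cong[OF o smooth_on_dird[OF smooth_ip[OF W Z]] dird_ip[OF W Z] p])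
      (simp_all add: dird_add[OF smooth_ip[OF smooth_cov[OF W] Z] smooth_ip[OF W smooth_cov[OF Z]] p]
        dird_ip[OF smooth_cov[OF W] Z p] dird_ip[OF W smooth_cov[OF Z] p])
  have "ip (\<lambda>p. cov y d (cov y e W) p - cov y e (cov y d W) p) Z 0
      + ip W (\<lambda>p. cov y d (cov y e Z) p - cov y e (cov y d Z) p) 0 = 0"
    using 2[of d e] 2[of e d] dird_commute[OF o smooth_ip[OF W Z] p, of d e]
    by (simp add: metric_inner_bilinear)
  moreover have "dird d y 0 = u" "dird e y 0 = v" by (simp_all add: y_eq d_def e_def)
  ultimately show ?thesis
    by (simp add: cov_commute[OF W p] cov_commute[OF Z p] y0) (simp add: W_def Z_def)
qed

text \<open>Add four Bianchi identities, one for each of u, v, w, z in the last slot. Skew symmetry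
  in the last pair cancels eight of the twelve terms, and the other four are twice the difference of
  the two sides.\<close>

lemma riemann_pair_sym:
  assumes x: "x \<in> \<Omega>"
  shows "metric_inner G x (riemann G x u v w) z = metric_inner G x (riemann G x w z u) v"
proof -
  define r where "r a b c d = metric_inner G x (riemann G x a b c) d" for a b c d
  have s12: "r a b c d = - r b a c d" for a b c d
    using riemann_skew_12[OF x, of a b c] by (simp add: r_def metric_inner_bilinear)
  have s34: "r a b c d = - r a b d c" for a b c d
    using riemann_skew_34[OF x, of a b c d] inner_sym[OF x] by (simp add: r_def)
  have b: "r a b c d + r b c a d + r c a b d = 0" for a b c d
    unfolding r_def metric_inner_bilinear(1)[symmetric] riemann_bianchi[OF x]
    by (simp add: metric_inner_bilinear)
  have "r u v w z = r w z u v"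
    using b[of v w u z] b[of w u z v] b[of u z v w] b[of z v w u]
      s34[of w u z v] s34[of u z v w] s34[of z v w u] s34[of v w z u]
      s12[of v u z w] s34[of u v z w] s12[of w z v u] s34[of z w v u] s12[of z w u v]
    by linarith
  then show ?thesis by (simp add: r_def)
qed

end

context riemannian_domain
begin

subsection \<open>Constant curvature\<close>

definition constant_sectional :: "real \<Rightarrow> bool"
  where "constant_sectional K \<longleftrightarrow> (\<forall>x\<in>\<Omega>. \<forall>u v. u \<noteq> v \<and> independent {u, v} \<longrightarrow>
    sectional_curvature G x u v = K)"

text \<open>Clearing the denominator admits u = 0, so \<open>riemann_polarized\<close> can use N, B
  and N + B without checking independence.\<close>

lemma sectional_orthogonal:
  assumes K: "constant_sectional K" and x: "x \<in> \<Omega>"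
    and T: "metric_inner G x T T = 1" and u: "metric_inner G x u T = 0"
  shows "metric_inner G x (riemann G x u T T) u = K * metric_inner G x u u"
proof (cases "u = 0")
  case True
  then show ?thesis by (simp add: metric_inner_bilinear)
next
  case False
  have "T \<noteq> 0" using T by (auto simp: metric_inner_bilinear)
  have "u \<notin> span {T}"
  proof
    assume "u \<in> span {T}"
    then obtain k where "u = k *\<^sub>R T" by (auto simp: span_singleton)
    then show False using u T False by (simp add: metric_inner_bilinear)
  qed
  moreover have "T \<in> span {T}" by (simp add: span_base)
  ultimately have "u \<noteq> T" "independent {u, T}"
    using \<open>T \<noteq> 0\<close> by (auto simp: independent_insert)
  then have "sectional_curvature G x u T = K" using K x by (simp add: constant_sectional_def)
  then show ?thesis
    using positive[OF x False] T u by (simp add: sectional_curvature_def field_simps)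
qed

lemma riemann_add_left: "riemann G x (u + u') v w = riemann G x u v w + riemann G x u' v w"
  by (simp add: riemann_def vec_eq_iff distrib_left distrib_right sum.distrib)

lemma riemann_scaleR_left: "riemann G x (a *\<^sub>R u) v w = a *\<^sub>R riemann G x u v w"
  by (simp add: riemann_def vec_eq_iff sum_distrib_left mult.assoc mult.left_commute)

text \<open>By pair symmetry the form <R(u,T)T, w> is symmetric in u and w. On vectors orthogonal to
  T its quadratic form is K times the metric, so polarization gives K <B, N> = 0.\<close>

lemma riemann_polarized:
  assumes K: "constant_sectional K" and x: "x \<in> \<Omega>"
    and T: "metric_inner G x T T = 1" and N: "metric_inner G x N T = 0"
    and B: "metric_inner G x B T = 0" and NB: "metric_inner G x N B = 0"
  shows "metric_inner G x (riemann G x B T T) N = 0"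
proof -
  have "metric_inner G x (riemann G x N T T) B = metric_inner G x (riemann G x B T T) N"
    using riemann_pair_sym[OF x, of N T T B] riemann_skew_12[OF x, of T B N]
      riemann_skew_34[OF x, of B T N T] inner_sym[OF x]
    by (simp add: metric_inner_bilinear)
  then show ?thesis
    using sectional_orthogonal[OF K x T N] sectional_orthogonal[OF K x T B]
      sectional_orthogonal[OF K x T, of "N + B"] N B NB inner_sym[OF x, of B N]
    by (simp add: metric_inner_bilinear riemann_add_left algebra_simps)
qed

section \<open>The metric cross product of an orthonormal pair\<close>

lemma metric_cross_inner:
  assumes x: "x \<in> \<Omega>"
  shows "metric_inner G x w (metric_cross G x u v) = sqrt (det (G x)) * (w \<bullet> cross3 u v)"
  by (simp add: metric_inner_def metric_cross_def matrix_vector_mult_scaleR inv_right[OF x])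

text \<open>Orthogonality is inherited from \<open>cross3\<close>. For the length, the cofactor
  identity M (Mu x Mv) = det M (u x v), valid for symmetric M, turns the squared norm into the Gram
  determinant of u and v.\<close>

lemma metric_cross_orthonormal:
  assumes x: "x \<in> \<Omega>" and u: "metric_inner G x u u = 1" and v: "metric_inner G x v v = 1"
    and uv: "metric_inner G x u v = 0"
  shows "metric_inner G x u (metric_cross G x u v) = 0"
    and "metric_inner G x v (metric_cross G x u v) = 0"
    and "metric_inner G x (metric_cross G x u v) (metric_cross G x u v) = 1"
proof -
  show "metric_inner G x u (metric_cross G x u v) = 0" "metric_inner G x v (metric_cross G x u v) = 0"
    by (simp_all add: metric_cross_inner[OF x] dot_cross_self)
  define M where "M = G x"
  have M: "0 < det M" "transpose M = M" using det_pos[OF x] symmetric[OF x] by (simp_all add: M_def)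
  have "M *v cross3 (M *v u) (M *v v) = det M *\<^sub>R cross3 u v"
    using cross_matrix_mult[of M u v] M(2) by simp
  then have "matrix_inv M *v (M *v cross3 (M *v u) (M *v v)) = det M *\<^sub>R (matrix_inv M *v cross3 u v)"
    by (simp add: matrix_vector_mult_scaleR)
  then have *: "cross3 (M *v u) (M *v v) = det M *\<^sub>R (matrix_inv M *v cross3 u v)"
    using inv_left[OF x] by (simp add: M_def)
  have "metric_inner G x (metric_cross G x u v) (metric_cross G x u v)
      = det M * ((matrix_inv M *v cross3 u v) \<bullet> cross3 u v)"
    using M(1) by (simp add: metric_cross_inner[OF x]) (simp add: metric_cross_def M_def)
  also have "\<dots> = cross3 u v \<bullet> cross3 (M *v u) (M *v v)"
    by (simp add: * inner_commute)
  also have "\<dots> = 1"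
    using u v uv inner_sym[OF x, of u v]
    by (simp add: dot_cross metric_inner_def M_def[symmetric])
  finally show "metric_inner G x (metric_cross G x u v) (metric_cross G x u v) = 1" .
qed

end

section \<open>Frenet frames moving by the vortex filament flow\<close>

text \<open>Parameters are pairs \<open>(t, s)\<close>.\<close>

abbreviation dir_s :: "real \<times> real" where "dir_s \<equiv> (0, 1)"
abbreviation dir_t :: "real \<times> real" where "dir_t \<equiv> (1, 0)"

text \<open>Isolates the moving-frame computation from the construction of the frame, which is
  carried out in \<open>frenet_chart\<close>.\<close>

locale vortex_frame = map_into_domain \<Omega> G U y
  for \<Omega> :: "(real^3) set" and G and U :: "(real \<times> real) set" and y +
  fixes T N B :: "real \<times> real \<Rightarrow> real^3" and \<kappa> \<tau> :: "real \<times> real \<Rightarrow> real" and K :: real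
  assumes K: "constant_sectional K"
    and smooth_frame: "smooth_on U T" "smooth_on U N" "smooth_on U B"
    and smooth_kt: "smooth_on U \<kappa>" "smooth_on U \<tau>"
    and orthonormal: "\<And>p. p \<in> U \<Longrightarrow> ip T T p = 1" "\<And>p. p \<in> U \<Longrightarrow> ip N N p = 1"
      "\<And>p. p \<in> U \<Longrightarrow> ip B B p = 1" "\<And>p. p \<in> U \<Longrightarrow> ip T N p = 0"
      "\<And>p. p \<in> U \<Longrightarrow> ip T B p = 0" "\<And>p. p \<in> U \<Longrightarrow> ip N B p = 0"
    and \<kappa>_nonzero: "\<And>p. p \<in> U \<Longrightarrow> \<kappa> p \<noteq> 0"
    and tangent: "\<And>p. p \<in> U \<Longrightarrow> dird dir_s y p = T p"
    and vortex: "\<And>p. p \<in> U \<Longrightarrow> dird dir_t y p = \<kappa> p *\<^sub>R B p"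
    and frenet_T: "\<And>p. p \<in> U \<Longrightarrow> cov y dir_s T p = \<kappa> p *\<^sub>R N p"
    and frenet_N: "\<And>p. p \<in> U \<Longrightarrow> cov y dir_s N p = \<tau> p *\<^sub>R B p - \<kappa> p *\<^sub>R T p"
    and frenet_B: "\<And>p. p \<in> U \<Longrightarrow> cov y dir_s B p = - \<tau> p *\<^sub>R N p"
begin

lemma ip_sym: "p \<in> U \<Longrightarrow> ip V W p = ip W V p"
  using inner_sym into by blast

lemma orthonormal_sym: "p \<in> U \<Longrightarrow> ip N T p = 0" "p \<in> U \<Longrightarrow> ip B T p = 0" "p \<in> U \<Longrightarrow> ip B N p = 0"
  using orthonormal(4-6) ip_sym by simp_all

lemma ip_cov_self:
  assumes V: "smooth_on U V" "\<And>p. p \<in> U \<Longrightarrow> ip V V p = 1" and p: "p \<in> U"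
  shows "ip (cov y e V) V p = 0"
proof -
  have "dird e (ip V V) p = dird e (\<lambda>p. 1) p"
    using V p by (intro dird_cong[OF open_U smooth_ip]) auto
  then show ?thesis using dird_ip[OF V(1) V(1) p, of e] ip_sym[OF p, of V "cov y e V"] by simp
qed

lemma curvature_terms:
  assumes p: "p \<in> U"
  shows "metric_inner G (y p) (riemann G (y p) (B p) (T p) (T p)) (B p) = K"
    and "metric_inner G (y p) (riemann G (y p) (B p) (T p) (T p)) (N p) = 0"
    and "metric_inner G (y p) (riemann G (y p) (B p) (T p) (N p)) (B p) = 0"
proof -
  note x = into[OF p] and o = orthonormal[OF p] orthonormal_sym[OF p]
  show "metric_inner G (y p) (riemann G (y p) (B p) (T p) (T p)) (B p) = K"
    using sectional_orthogonal[OF K x o(1) o(8)] o(3) by simp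
  show "metric_inner G (y p) (riemann G (y p) (B p) (T p) (T p)) (N p) = 0"
    by (rule riemann_polarized[OF K x o(1,7,8,6)])
  \<comment> \<open>The same polarization with B as the unit vector and T, N as the orthogonal
    pair.\<close>
  have "metric_inner G (y p) (riemann G (y p) (T p) (B p) (B p)) (N p) = 0"
    by (rule riemann_polarized[OF K x o(3,6,5,7)])
  then show "metric_inner G (y p) (riemann G (y p) (B p) (T p) (N p)) (B p) = 0"
    using riemann_skew_12[OF x, of "B p" "T p" "B p"]
      riemann_skew_34[OF x, of "B p" "T p" "N p" "B p"] inner_sym[OF x]
    by (simp add: metric_inner_bilinear)
qed

lemma cov_t_T:
  assumes p: "p \<in> U"
  shows "cov y dir_t T p = dird dir_s \<kappa> p *\<^sub>R B p - (\<kappa> p * \<tau> p) *\<^sub>R N p"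
proof -
  have "cov y dir_t T p = cov y dir_t (dird dir_s y) p"
    by (rule cov_cong[OF smooth_frame(1) _ p]) (simp add: tangent)
  also have "\<dots> = cov y dir_s (dird dir_t y) p"
    by (rule cov_torsion_free[OF p])
  also have "\<dots> = cov y dir_s (\<lambda>p. \<kappa> p *\<^sub>R B p) p"
    by (rule cov_cong[OF smooth_on_dird[OF smooth_y] vortex p])
  also have "\<dots> = dird dir_s \<kappa> p *\<^sub>R B p + \<kappa> p *\<^sub>R cov y dir_s B p"
    by (rule cov_scaleR[OF smooth_kt(1) smooth_frame(3) p])
  finally show ?thesis by (simp add: frenet_B[OF p])
qed

text \<open>The unknowns here are \<kappa>_t and D_t N. As N is a unit field, D_t N has no N
  component, so the N component of the identity gives \<kappa>_t and the B component gives <D_t N,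
  B>.\<close>

lemma cov_t_s_T:
  assumes p: "p \<in> U"
  shows "dird dir_t \<kappa> p *\<^sub>R N p + \<kappa> p *\<^sub>R cov y dir_t N p =
    dird dir_s (dird dir_s \<kappa>) p *\<^sub>R B p - (dird dir_s \<kappa> p * \<tau> p) *\<^sub>R N p
    - dird dir_s (\<lambda>p. \<kappa> p * \<tau> p) p *\<^sub>R N p
    - (\<kappa> p * \<tau> p) *\<^sub>R (\<tau> p *\<^sub>R B p - \<kappa> p *\<^sub>R T p)
    + \<kappa> p *\<^sub>R riemann G (y p) (B p) (T p) (T p)"
proof -
  note ks = smooth_on_dird[OF smooth_kt(1), of dir_s]
    and kt = smooth_on_mult[OF open_U smooth_kt]
  have "cov y dir_t (cov y dir_s T) p = cov y dir_t (\<lambda>p. \<kappa> p *\<^sub>R N p) p"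
    by (rule cov_cong[OF smooth_cov[OF smooth_frame(1)] frenet_T p])
  also have "\<dots> = dird dir_t \<kappa> p *\<^sub>R N p + \<kappa> p *\<^sub>R cov y dir_t N p"
    by (rule cov_scaleR[OF smooth_kt(1) smooth_frame(2) p])
  finally have 1: "cov y dir_t (cov y dir_s T) p = dird dir_t \<kappa> p *\<^sub>R N p + \<kappa> p *\<^sub>R cov y dir_t N p" .
  have "cov y dir_s (cov y dir_t T) p =
      cov y dir_s (\<lambda>p. dird dir_s \<kappa> p *\<^sub>R B p - (\<kappa> p * \<tau> p) *\<^sub>R N p) p"
    by (rule cov_cong[OF smooth_cov[OF smooth_frame(1)] cov_t_T p])
  also have "\<dots> = (dird dir_s (dird dir_s \<kappa>) p *\<^sub>R B p + dird dir_s \<kappa> p *\<^sub>R cov y dir_s B p)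
      - (dird dir_s (\<lambda>p. \<kappa> p * \<tau> p) p *\<^sub>R N p + (\<kappa> p * \<tau> p) *\<^sub>R cov y dir_s N p)"
    unfolding cov_diff[OF smooth_on_scaleR[OF open_U ks smooth_frame(3)]
        smooth_on_scaleR[OF open_U kt smooth_frame(2)] p]
      cov_scaleR[OF ks smooth_frame(3) p] cov_scaleR[OF kt smooth_frame(2) p] ..
  finally have 2: "cov y dir_s (cov y dir_t T) p =
    dird dir_s (dird dir_s \<kappa>) p *\<^sub>R B p - (dird dir_s \<kappa> p * \<tau> p) *\<^sub>R N p
    - dird dir_s (\<lambda>p. \<kappa> p * \<tau> p) p *\<^sub>R N p
    - (\<kappa> p * \<tau> p) *\<^sub>R (\<tau> p *\<^sub>R B p - \<kappa> p *\<^sub>R T p)"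
    by (simp add: frenet_B[OF p] frenet_N[OF p])
  show ?thesis
    using cov_commute[OF smooth_frame(1) p, of dir_t dir_s]
    unfolding 1 2 vortex[OF p] tangent[OF p] riemann_scaleR_left by (simp add: algebra_simps)
qed

lemma curvature_evolution:
  assumes p: "p \<in> U"
  shows "dird dir_t \<kappa> p = - (2 * dird dir_s \<kappa> p * \<tau> p + \<kappa> p * dird dir_s \<tau> p)"
  using arg_cong[OF cov_t_s_T[OF p], of "\<lambda>v. metric_inner G (y p) v (N p)"]
  by (simp add: metric_inner_bilinear orthonormal[OF p] orthonormal_sym[OF p] curvature_terms[OF p]
      ip_cov_self[OF smooth_frame(2) orthonormal(2) p] dird_mult[OF smooth_kt p])

text \<open>The rate at which the flow turns the frame about T, in the normal plane; the formula is
  the B component of \<open>cov_t_s_T\<close> divided by \<kappa>.\<close>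

definition normal_rotation :: "real \<times> real \<Rightarrow> real"
  where "normal_rotation p = dird dir_s (dird dir_s \<kappa>) p / \<kappa> p - (\<tau> p)\<^sup>2 + K"

lemma normal_rotation:
  assumes p: "p \<in> U"
  shows "ip (cov y dir_t N) B p = normal_rotation p"
  using arg_cong[OF cov_t_s_T[OF p], of "\<lambda>v. metric_inner G (y p) v (B p)"] \<kappa>_nonzero[OF p]
  by (simp add: metric_inner_bilinear orthonormal[OF p] orthonormal_sym[OF p] curvature_terms[OF p]
      normal_rotation_def field_simps power2_eq_square)

text \<open>The B components of D_t D_s N and D_s D_t N agree because the curvature term has none.
  The first is \<tau>_t - \<kappa> \<kappa>_s. The second is the s-derivative of <D_t N, B>, because
  D_s B is parallel to N and D_t N is orthogonal to N.\<close>

lemma torsion_evolution: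
  assumes p: "p \<in> U"
  shows "dird dir_t \<tau> p = dird dir_s normal_rotation p + \<kappa> p * dird dir_s \<kappa> p"
proof -
  note smk = smooth_on_scaleR[OF open_U smooth_kt(2) smooth_frame(3)]
    smooth_on_scaleR[OF open_U smooth_kt(1) smooth_frame(1)]
  have "cov y dir_t (cov y dir_s N) p = cov y dir_t (\<lambda>p. \<tau> p *\<^sub>R B p - \<kappa> p *\<^sub>R T p) p"
    by (rule cov_cong[OF smooth_cov[OF smooth_frame(2)] frenet_N p])
  also have "\<dots> = (dird dir_t \<tau> p *\<^sub>R B p + \<tau> p *\<^sub>R cov y dir_t B p)
      - (dird dir_t \<kappa> p *\<^sub>R T p + \<kappa> p *\<^sub>R cov y dir_t T p)"
    unfolding cov_diff[OF smk p] cov_scaleR[OF smooth_kt(2) smooth_frame(3) p]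
      cov_scaleR[OF smooth_kt(1) smooth_frame(1) p] ..
  finally have 1: "ip (cov y dir_t (cov y dir_s N)) B p = dird dir_t \<tau> p - \<kappa> p * dird dir_s \<kappa> p"
    by (simp add: metric_inner_bilinear orthonormal[OF p] orthonormal_sym[OF p] cov_t_T[OF p]
      ip_cov_self[OF smooth_frame(3) orthonormal(3) p])
  have "dird dir_s normal_rotation p = dird dir_s (ip (cov y dir_t N) B) p"
    by (rule dird_cong[OF open_U smooth_ip[OF smooth_cov[OF smooth_frame(2)] smooth_frame(3)]
          normal_rotation p, symmetric])
  also have "\<dots> = ip (cov y dir_s (cov y dir_t N)) B p + ip (cov y dir_t N) (cov y dir_s B) p"
    by (rule dird_ip[OF smooth_cov[OF smooth_frame(2)] smooth_frame(3) p])
  finally have 2: "ip (cov y dir_s (cov y dir_t N)) B p = dird dir_s normal_rotation p"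
    by (simp add: frenet_B[OF p] metric_inner_bilinear
        ip_cov_self[OF smooth_frame(2) orthonormal(2) p])
  have "ip (cov y dir_t (cov y dir_s N)) B p - ip (cov y dir_s (cov y dir_t N)) B p = 0"
    unfolding metric_inner_bilinear(3)[symmetric] cov_commute[OF smooth_frame(2) p]
      vortex[OF p] tangent[OF p] riemann_scaleR_left
    by (simp add: metric_inner_bilinear curvature_terms[OF p])
  then show ?thesis using 1 2 by simp
qed

text \<open>The potential differs from the rate of rotation by \<open>\<kappa>\<^sup>2/2 - K\<close>; the constant \<open>K\<close> drops out.\<close>

lemma torsion_evolution_potential:
  assumes p: "p \<in> U"
  shows "dird dir_t \<tau> p = dird dir_s (\<lambda>p. dird dir_s (dird dir_s \<kappa>) p / \<kappa> p - (\<tau> p)\<^sup>2 + (\<kappa> p)\<^sup>2 / 2) p"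
proof -
  have r: "smooth_on U normal_rotation"
    unfolding normal_rotation_def[abs_def] power2_eq_square
    by (intro smooth_intros smooth_on_dird smooth_kt open_U \<kappa>_nonzero)
  have k: "smooth_on U (\<lambda>p. (1/2) * (\<kappa> p * \<kappa> p))"
    by (intro smooth_intros smooth_kt open_U)
  have eq: "(\<lambda>p. dird dir_s (dird dir_s \<kappa>) p / \<kappa> p - (\<tau> p)\<^sup>2 + (\<kappa> p)\<^sup>2 / 2)
      = (\<lambda>p. (normal_rotation p + (1/2) * (\<kappa> p * \<kappa> p)) - K)"
    by (simp add: normal_rotation_def power2_eq_square fun_eq_iff)
  show ?thesis
    unfolding eq torsion_evolution[OF p]
      dird_diff[OF smooth_on_add[OF open_U r k] smooth_on_const p] dird_add[OF r k p]
      dird_mult[OF smooth_on_const smooth_on_mult[OF open_U smooth_kt(1,1)] p]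
      dird_mult[OF smooth_kt(1,1) p]
    by simp
qed

end

section \<open>The Frenet frame in a chart\<close>

text \<open>The bridge between one-variable derivatives, in which the notions for curves are stated,
  and directional derivatives in the parameter plane.\<close>

lemma has_vector_derivative_section:
  fixes f :: "real \<times> real \<Rightarrow> 'b::euclidean_space"
  assumes "smooth_on U f" "(t, s) \<in> U"
  shows "((\<lambda>s. f (t, s)) has_vector_derivative dird dir_s f (t, s)) (at s)"
    and "((\<lambda>t. f (t, s)) has_vector_derivative dird dir_t f (t, s)) (at t)"
  using has_vector_derivative_line[OF assms(1), of "(t, 0)" s dir_s]
    has_vector_derivative_line[OF assms(1), of "(0, s)" t dir_t] assms(2) by simp_all

text \<open>Here \<kappa> and \<tau> are bare functions tied to the curves by the Frenet formulas;
  their smoothness in (t, s) is a result of this locale.\<close>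

locale frenet_chart = map_into_domain \<Omega> G U y
  for \<Omega> :: "(real^3) set" and G and U :: "(real \<times> real) set" and y +
  fixes \<kappa> \<tau> :: "real \<Rightarrow> real \<Rightarrow> real" and K :: real
  assumes K: "constant_sectional K"
    and arclength: "\<And>t s. (t, s) \<in> U \<Longrightarrow> metric_norm G (y (t, s)) (velocity (\<lambda>s. y (t, s)) s) = 1"
    and trace: "\<And>t s. (t, s) \<in> U \<Longrightarrow> trace_sff G (\<lambda>s. y (t, s)) s \<noteq> 0"
    and frenet: "\<And>t s. (t, s) \<in> U \<Longrightarrow>
      cov_deriv G (\<lambda>s. y (t, s)) (unit_tangent G (\<lambda>s. y (t, s))) s =
        \<kappa> t s *\<^sub>R principal_normal G (\<lambda>s. y (t, s)) s"
      "\<And>t s. (t, s) \<in> U \<Longrightarrow>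
      cov_deriv G (\<lambda>s. y (t, s)) (principal_normal G (\<lambda>s. y (t, s))) s =
        - \<kappa> t s *\<^sub>R unit_tangent G (\<lambda>s. y (t, s)) s + \<tau> t s *\<^sub>R binormal G (\<lambda>s. y (t, s)) s"
      "\<And>t s. (t, s) \<in> U \<Longrightarrow>
      cov_deriv G (\<lambda>s. y (t, s)) (binormal G (\<lambda>s. y (t, s))) s =
        - \<tau> t s *\<^sub>R principal_normal G (\<lambda>s. y (t, s)) s"
    and vortex: "\<And>t s. (t, s) \<in> U \<Longrightarrow>
      vector_derivative (\<lambda>r. y (r, s)) (at t) = \<kappa> t s *\<^sub>R binormal G (\<lambda>s. y (t, s)) s"
begin

definition T :: "real \<times> real \<Rightarrow> real^3" where "T p = unit_tangent G (\<lambda>s. y (fst p, s)) (snd p)"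
definition N :: "real \<times> real \<Rightarrow> real^3" where "N p = principal_normal G (\<lambda>s. y (fst p, s)) (snd p)"
definition B :: "real \<times> real \<Rightarrow> real^3" where "B p = binormal G (\<lambda>s. y (fst p, s)) (snd p)"
definition k :: "real \<times> real \<Rightarrow> real" where "k p = \<kappa> (fst p) (snd p)"
definition u :: "real \<times> real \<Rightarrow> real" where "u p = \<tau> (fst p) (snd p)"

lemma frame_sections:
  "unit_tangent G (\<lambda>s. y (t, s)) = (\<lambda>s. T (t, s))"
  "principal_normal G (\<lambda>s. y (t, s)) = (\<lambda>s. N (t, s))"
  "binormal G (\<lambda>s. y (t, s)) = (\<lambda>s. B (t, s))"
  by (simp_all add: T_def N_def B_def)

lemma velocity_section: "(t, s) \<in> U \<Longrightarrow> velocity (\<lambda>s. y (t, s)) s = dird dir_s y (t, s)"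
  unfolding velocity_def by (rule vector_derivative_at[OF has_vector_derivative_section(1)[OF smooth_y]])

lemma cov_deriv_section:
  assumes "smooth_on U V" "(t, s) \<in> U"
  shows "cov_deriv G (\<lambda>s. y (t, s)) (\<lambda>s. V (t, s)) s = cov y dir_s V (t, s)"
  by (simp add: cov_deriv_def cov_def chr_def velocity_section[OF assms(2)]
      vector_derivative_at[OF has_vector_derivative_section(1)[OF assms]])

lemma tangent: "p \<in> U \<Longrightarrow> dird dir_s y p = T p"
  using arclength[of "fst p" "snd p"] velocity_section[of "fst p" "snd p"]
  by (simp add: T_def unit_tangent_def)

lemma TT: "p \<in> U \<Longrightarrow> ip T T p = 1"
  using arclength[of "fst p" "snd p"] velocity_section[of "fst p" "snd p"] tangent[of p]
  by (simp add: metric_norm_def)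

lemma smooth_T: "smooth_on U T"
  by (rule smooth_on_cong[OF open_U smooth_on_dird[OF smooth_y] tangent])

lemma T_cov_T: "p \<in> U \<Longrightarrow> ip (cov y dir_s T) T p = 0"
proof -
  assume p: "p \<in> U"
  have "dird dir_s (ip T T) p = dird dir_s (\<lambda>p. 1) p"
    by (rule dird_cong[OF open_U smooth_ip[OF smooth_T smooth_T] TT p])
  then show ?thesis
    using dird_ip[OF smooth_T smooth_T p, of dir_s] inner_sym[OF into[OF p], of "T p" "cov y dir_s T p"]
    by simp
qed

text \<open>At unit speed D_s T is already orthogonal to T, so taking the normal part changes
  nothing.\<close>

lemma trace_eq: "(t, s) \<in> U \<Longrightarrow> trace_sff G (\<lambda>s. y (t, s)) s = cov y dir_s T (t, s)"
  using TT T_cov_T arclength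
  by (simp add: trace_sff_def second_fundamental_form_def normal_part_def frame_sections
      cov_deriv_section[OF smooth_T])

text \<open>Oriented from the explicit formula to N because smoothness is transported in that
  direction by \<open>smooth_on_cong\<close>.\<close>

lemma N_eq: "p \<in> U \<Longrightarrow>
    inverse (sqrt (ip (cov y dir_s T) (cov y dir_s T) p)) *\<^sub>R cov y dir_s T p = N p"
  using trace_eq[of "fst p" "snd p"] by (simp add: N_def principal_normal_def metric_norm_def)

lemma cov_T_pos: "p \<in> U \<Longrightarrow> 0 < ip (cov y dir_s T) (cov y dir_s T) p"
  using trace_eq[of "fst p" "snd p"] trace[of "fst p" "snd p"] positive[OF into[of p]] by simp

lemma smooth_N: "smooth_on U N"
proof (rule smooth_on_cong[OF open_U _ N_eq])
  note c = smooth_cov[OF smooth_T, of dir_s]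
  have nz: "sqrt (ip (cov y dir_s T) (cov y dir_s T) p) \<noteq> 0" if "p \<in> U" for p
    using cov_T_pos[OF that] by simp
  show "smooth_on U (\<lambda>p. inverse (sqrt (ip (cov y dir_s T) (cov y dir_s T) p)) *\<^sub>R cov y dir_s T p)"
    by (intro smooth_on_scaleR smooth_on_inverse smooth_on_sqrt smooth_ip c open_U cov_T_pos nz)
qed

lemma NN: "p \<in> U \<Longrightarrow> ip N N p = 1" and TN: "p \<in> U \<Longrightarrow> ip T N p = 0"
proof -
  assume p: "p \<in> U"
  show "ip N N p = 1"
    using cov_T_pos[OF p]
    by (simp add: N_eq[OF p, symmetric] metric_inner_bilinear field_simps)
  show "ip T N p = 0"
    using T_cov_T[OF p] inner_sym[OF into[OF p], of "T p"]
    by (simp add: N_eq[OF p, symmetric] metric_inner_bilinear)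
qed

lemma B_eq: "B p = metric_cross G (y p) (T p) (N p)"
  by (simp add: B_def binormal_def T_def N_def)

lemma smooth_B: "smooth_on U B"
proof -
  have c: "smooth_on U (\<lambda>p. cross3 (T p) (N p))"
    by (rule smooth_on_bilinear[OF open_U _ smooth_T smooth_N])
      (use bilinear_cross bilinear_conv_bounded_bilinear in blast)
  have i: "smooth_on \<Omega> (\<lambda>x. matrix_inv (G x))"
    using det_pos by (intro smooth_on_matrix_inv open_domain smooth) force
  have d: "smooth_on \<Omega> (\<lambda>x. sqrt (det (G x)))"
    using det_pos by (intro smooth_on_sqrt smooth_on_det open_domain smooth) force
  show ?thesis
    unfolding B_eq[abs_def] metric_cross_def matrix_vector_mult_def
    by (intro smooth_on_scaleR smooth_on_vec_lambda smooth_on_sum smooth_on_mult smooth_on_vec_nth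
        smooth_along[OF i] smooth_along[OF d] c open_U)
qed

lemmas B_orthonormal = metric_cross_orthonormal[OF into TT NN TN, folded B_eq]

section \<open>Curvature and torsion as smooth functions of both parameters\<close>

lemma frenet_frame:
  assumes p: "p \<in> U"
  shows "cov y dir_s T p = k p *\<^sub>R N p"
    and "cov y dir_s N p = u p *\<^sub>R B p - k p *\<^sub>R T p"
    and "cov y dir_s B p = - u p *\<^sub>R N p"
  using frenet[of "fst p" "snd p"] p cov_deriv_section[of _ "fst p" "snd p"] smooth_T smooth_N smooth_B
  by (simp_all add: frame_sections k_def u_def)

text \<open>Solving the Frenet formula for its coefficient expresses \<kappa> through smooth fields;
  \<open>torsion_eq\<close> does the same for \<tau>.\<close>

lemma curvature_eq: "p \<in> U \<Longrightarrow> ip (cov y dir_s T) N p = k p"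
  by (simp add: frenet_frame metric_inner_bilinear NN)

lemma torsion_eq: "p \<in> U \<Longrightarrow> ip (cov y dir_s N) B p = u p"
  by (simp add: frenet_frame metric_inner_bilinear B_orthonormal)

lemma smooth_curvature: "smooth_on U k"
  by (rule smooth_on_cong[OF open_U smooth_ip[OF smooth_cov[OF smooth_T] smooth_N] curvature_eq])

lemma smooth_torsion: "smooth_on U u"
  by (rule smooth_on_cong[OF open_U smooth_ip[OF smooth_cov[OF smooth_N] smooth_B] torsion_eq])

lemma curvature_nonzero: "p \<in> U \<Longrightarrow> k p \<noteq> 0"
  using cov_T_pos[of p] by (auto simp: frenet_frame metric_inner_bilinear)

lemma vortex_section: "p \<in> U \<Longrightarrow> dird dir_t y p = k p *\<^sub>R B p"
  using vortex[of "fst p" "snd p"]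
    vector_derivative_at[OF has_vector_derivative_section(2)[OF smooth_y, of "fst p" "snd p"]]
  by (simp add: frame_sections k_def)

sublocale vortex_frame \<Omega> G U y T N B k u K
  by unfold_locales
    (simp_all add: K smooth_T smooth_N smooth_B smooth_curvature smooth_torsion TT NN TN
      B_orthonormal curvature_nonzero tangent vortex_section frenet_frame)

end

section \<open>The Schroedinger equation\<close>

lemma smooth_on_section:
  assumes "smooth_on (I \<times> UNIV) f" "t \<in> I"
  shows "continuous_on S (\<lambda>s. f (t, s))"
  by (rule continuous_on_compose2[OF smooth_on_continuous_on[OF assms(1)]])
    (use assms(2) in \<open>auto intro!: continuous_intros\<close>)

lemma has_vector_derivative_of_real:
  "(f has_vector_derivative f') F \<Longrightarrow>
    ((\<lambda>x. complex_of_real (f x)) has_vector_derivative complex_of_real f') F"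
  by (rule bounded_linear.has_vector_derivative[OF bounded_linear_of_real])

text \<open>A phase factor turns the derivative of the amplitude a into a' + i \<theta>' a. This one
  rule covers both derivatives in s, the derivative in t, and the gauge factor.\<close>

lemma has_vector_derivative_phase:
  assumes a: "(a has_vector_derivative a') (at s)" and \<theta>: "(\<theta> has_vector_derivative \<theta>') (at s)"
  shows "((\<lambda>s. a s * exp (\<i> * complex_of_real (\<theta> s))) has_vector_derivative
    (a' + \<i> * complex_of_real \<theta>' * a s) * exp (\<i> * complex_of_real (\<theta> s))) (at s)"
proof -
  have "((\<lambda>s. \<i> * complex_of_real (\<theta> s)) has_vector_derivative \<i> * complex_of_real \<theta>') (at s)"
    by (rule has_vector_derivative_mult_right[OF has_vector_derivative_of_real[OF \<theta>]])
  then have "((\<lambda>s. exp (\<i> * complex_of_real (\<theta> s))) has_vector_derivative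
      \<i> * complex_of_real \<theta>' * exp (\<i> * complex_of_real (\<theta> s))) (at s)"
    using field_vector_diff_chain_at[of "\<lambda>s. \<i> * complex_of_real (\<theta> s)" _ s exp] DERIV_exp
    by (auto simp: o_def)
  from has_vector_derivative_mult[OF a this] show ?thesis
    by (simp add: algebra_simps)
qed

text \<open>The interval surrounds both c and x, so the derivative is two-sided and x may lie on
  either side of c.\<close>

lemma has_vector_derivative_interval_integral:
  fixes f :: "real \<Rightarrow> real"
  assumes f: "continuous_on {a..b} f" and c: "a < c" "c < b" and x: "a < x" "x < b"
  shows "((\<lambda>v. LBINT y=c..v. f y) has_vector_derivative f x) (at x)"
proof -
  have "((\<lambda>v. LBINT y=c..v. f y) has_vector_derivative f x) (at x within {a..b})"
    by (rule interval_integral_FTC2) (use assms in auto)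
  then show ?thesis
    using at_within_interior[of x "{a..b}"] x by simp
qed

text \<open>All that the geometry contributes. The function f extends the expression defining A(t)
  from s = 0 to every s.\<close>

locale hasimoto_evolution =
  fixes \<epsilon> :: real and \<kappa> \<tau> :: "real \<Rightarrow> real \<Rightarrow> real"
    and k u f :: "real \<times> real \<Rightarrow> real"
  assumes k: "k = (\<lambda>p. \<kappa> (fst p) (snd p))" and u: "u = (\<lambda>p. \<tau> (fst p) (snd p))"
    and f: "f = (\<lambda>p. dird dir_s (dird dir_s k) p / k p - (u p)\<^sup>2 + (k p)\<^sup>2 / 2)"
    and \<epsilon>: "0 < \<epsilon>"
    and smooth: "smooth_on ({-\<epsilon><..<\<epsilon>} \<times> UNIV) k" "smooth_on ({-\<epsilon><..<\<epsilon>} \<times> UNIV) u"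
    and nonzero: "\<And>t s. t \<in> {-\<epsilon><..<\<epsilon>} \<Longrightarrow> k (t, s) \<noteq> 0"
    and curvature: "\<And>t s. t \<in> {-\<epsilon><..<\<epsilon>} \<Longrightarrow> dird dir_t k (t, s) =
      - (2 * dird dir_s k (t, s) * u (t, s) + k (t, s) * dird dir_s u (t, s))"
    and torsion: "\<And>t s. t \<in> {-\<epsilon><..<\<epsilon>} \<Longrightarrow> dird dir_t u (t, s) = dird dir_s f (t, s)"
begin

abbreviation "I \<equiv> {-\<epsilon><..<\<epsilon>}"

lemma smooth_f: "smooth_on (I \<times> UNIV) f"
  unfolding f power2_eq_square
  by (intro smooth_intros smooth_on_dird smooth open_Times) (use nonzero in auto)

lemma ds: "t \<in> I \<Longrightarrow> smooth_on (I \<times> UNIV) h \<Longrightarrow>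
    ((\<lambda>s. h (t, s)) has_vector_derivative dird dir_s h (t, s)) (at s)"
  and dt: "t \<in> I \<Longrightarrow> smooth_on (I \<times> UNIV) h \<Longrightarrow>
    ((\<lambda>t. h (t, s)) has_vector_derivative dird dir_t h (t, s)) (at t)"
  for h :: "real \<times> real \<Rightarrow> real"
  using has_vector_derivative_section[of "I \<times> UNIV" h t s] by auto

lemma potential: "t \<in> I \<Longrightarrow> hasimoto_potential \<kappa> \<tau> t = f (t, 0)"
proof -
  assume t: "t \<in> I"
  have "deriv (\<kappa> t) = (\<lambda>s. dird dir_s k (t, s))"
    using ds[OF t smooth(1)]
    by (auto simp: k has_real_derivative_iff_has_vector_derivative intro!: DERIV_imp_deriv)
  moreover have "deriv (\<lambda>s. dird dir_s k (t, s)) = (\<lambda>s. dird dir_s (dird dir_s k) (t, s))"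
    using ds[OF t smooth_on_dird[OF smooth(1)]]
    by (auto simp: has_real_derivative_iff_has_vector_derivative intro!: DERIV_imp_deriv)
  ultimately show ?thesis
    by (simp add: hasimoto_potential_def f) (simp add: k u)
qed

section \<open>The phase and its derivatives\<close>

definition \<theta> :: "real \<Rightarrow> real \<Rightarrow> real" where "\<theta> t s = (LBINT x=0..s. \<tau> t x)"

lemma phase_s: "t \<in> I \<Longrightarrow> (\<theta> t has_vector_derivative u (t, s)) (at s)"
  \<comment> \<open>These bounds put both 0 and s in the interior, whatever the sign of s.\<close>
  using has_vector_derivative_interval_integral[of "- \<bar>s\<bar> - 1" "\<bar>s\<bar> + 1" "\<tau> t" 0 s]
    smooth_on_section[OF smooth(2)]
  by (auto simp: \<theta>_def[abs_def] u zero_ereal_def)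

text \<open>After differentiation under the integral the integrand is the s-derivative of f, by the
  torsion equation, so the integral is a boundary difference.\<close>

lemma integral_t:
  assumes t: "t \<in> I" and ab: "a \<le> b"
  shows "((\<lambda>t. integral {a..b} (\<lambda>x. u (t, x))) has_vector_derivative f (t, b) - f (t, a)) (at t)"
proof -
  have "((\<lambda>x. dird dir_t u (t, x)) has_integral f (t, b) - f (t, a)) {a..b}"
    using ds[OF t smooth_f] t
    by (intro fundamental_theorem_of_calculus ab)
      (auto simp: torsion intro: has_vector_derivative_at_within)
  then have int: "integral (cbox a b) (\<lambda>x. dird dir_t u (t, x)) = f (t, b) - f (t, a)"
    by (simp add: integral_unique)
  have "((\<lambda>t. integral (cbox a b) (\<lambda>x. u (t, x))) has_vector_derivative
      integral (cbox a b) (\<lambda>x. dird dir_t u (t, x))) (at t within I)"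
  proof (rule leibniz_rule_vector_derivative)
    show "continuous_on (I \<times> cbox a b) (\<lambda>(t, x). dird dir_t u (t, x))"
      unfolding case_prod_unfold prod.collapse
      by (rule continuous_on_subset[OF smooth_on_continuous_on[OF smooth_on_dird[OF smooth(2)]]]) auto
    show "(\<lambda>x. u (t, x)) integrable_on cbox a b" if "t \<in> I" for t
      by (rule integrable_continuous[OF smooth_on_section[OF smooth(2) that]])
  qed (use t dt[OF _ smooth(2)] in \<open>auto intro: has_vector_derivative_at_within\<close>)
  then show ?thesis
    using t at_within_open[of t I] unfolding int by simp
qed

lemma phase_t:
  assumes t: "t \<in> I"
  shows "((\<lambda>t. \<theta> t s) has_vector_derivative f (t, s) - f (t, 0)) (at t)"
proof -
  have LB: "(LBINT x=a..b. u (t, x)) = integral {a..b} (\<lambda>x. u (t, x))" if "a \<le> b" "t \<in> I" for a b t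
    using that smooth_on_section[OF smooth(2)]
    by (intro interval_integral_eq_integral) (auto intro: borel_integrable_atLeastAtMost')
  \<comment> \<open>\<open>integral_t\<close> needs ordered endpoints. For negative s the interval
    is reversed, and the sign change restores the same derivative.\<close>
  have "((\<lambda>t. if 0 \<le> s then integral {0..s} (\<lambda>x. u (t, x)) else - integral {s..0} (\<lambda>x. u (t, x)))
      has_vector_derivative f (t, s) - f (t, 0)) (at t)"
    using integral_t[OF t, of 0 s] has_vector_derivative_minus[OF integral_t[OF t, of s 0]]
    by (cases "0 \<le> s") simp_all
  then show ?thesis
  proof (rule has_vector_derivative_transform_within_open[OF _ _ t])
    fix t assume "t \<in> I"
    have "\<theta> t s = (LBINT x=0..s. u (t, x))" by (simp add: \<theta>_def u)
    then show "(if 0 \<le> s then integral {0..s} (\<lambda>x. u (t, x)) else - integral {s..0} (\<lambda>x. u (t, x))) = \<theta> t s"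
      using LB[OF _ \<open>t \<in> I\<close>, of 0 s] LB[OF _ \<open>t \<in> I\<close>, of s 0]
        interval_integral_endpoints_reverse[of 0 s "\<lambda>x. u (t, x)"]
      by (auto simp: zero_ereal_def)
  qed auto
qed

section \<open>The wave function and its derivatives\<close>

definition E :: "real \<Rightarrow> real \<Rightarrow> complex" where "E t s = exp (\<i> * complex_of_real (\<theta> t s))"

lemma hasimoto_eq: "hasimoto \<kappa> \<tau> t s = complex_of_real (k (t, s)) * E t s"
  by (simp add: hasimoto_def E_def \<theta>_def k)

text \<open>The closed forms here and in the next two definitions have the shape (a' + i \<theta>'
  a) E given by \<open>has_vector_derivative_phase\<close>; for the second s-derivative the
  amplitude a is the bracket of this one.\<close>

definition \<psi>_s :: "real \<Rightarrow> real \<Rightarrow> complex" where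
  "\<psi>_s t s = (of_real (dird dir_s k (t, s)) + \<i> * of_real (u (t, s)) * of_real (k (t, s))) * E t s"

definition \<psi>_ss :: "real \<Rightarrow> real \<Rightarrow> complex" where
  "\<psi>_ss t s = ((of_real (dird dir_s (dird dir_s k) (t, s))
      + \<i> * of_real (dird dir_s u (t, s) * k (t, s) + u (t, s) * dird dir_s k (t, s)))
    + \<i> * of_real (u (t, s)) * (of_real (dird dir_s k (t, s)) + \<i> * of_real (u (t, s)) * of_real (k (t, s))))
    * E t s"

definition \<psi>_t :: "real \<Rightarrow> real \<Rightarrow> complex" where
  "\<psi>_t t s = (of_real (dird dir_t k (t, s)) + \<i> * of_real (f (t, s) - f (t, 0)) * of_real (k (t, s))) * E t s"

lemma hasimoto_s:
  assumes t: "t \<in> I"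
  shows "(hasimoto \<kappa> \<tau> t has_vector_derivative \<psi>_s t s) (at s)"
  unfolding hasimoto_eq[abs_def] E_def \<psi>_s_def
  by (rule has_vector_derivative_phase[OF has_vector_derivative_of_real[OF ds[OF t smooth(1)]] phase_s[OF t]])

lemma hasimoto_ss:
  assumes t: "t \<in> I"
  shows "(\<psi>_s t has_vector_derivative \<psi>_ss t s) (at s)"
  unfolding \<psi>_s_def[abs_def] E_def \<psi>_ss_def
proof (rule has_vector_derivative_phase[OF _ phase_s[OF t]])
  have "((\<lambda>s. \<i> * of_real (u (t, s) * k (t, s))) has_vector_derivative
      \<i> * of_real (u (t, s) * dird dir_s k (t, s) + dird dir_s u (t, s) * k (t, s))) (at s)"
    by (intro has_vector_derivative_mult_right has_vector_derivative_of_real has_vector_derivative_mult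
        ds[OF t smooth(1)] ds[OF t smooth(2)])
  from has_vector_derivative_add[OF
      has_vector_derivative_of_real[OF ds[OF t smooth_on_dird[OF smooth(1)]]] this]
  show "((\<lambda>s. of_real (dird dir_s k (t, s)) + \<i> * of_real (u (t, s)) * of_real (k (t, s)))
    has_vector_derivative of_real (dird dir_s (dird dir_s k) (t, s))
      + \<i> * of_real (dird dir_s u (t, s) * k (t, s) + u (t, s) * dird dir_s k (t, s))) (at s)"
    by (simp add: mult.assoc add.commute)
qed

lemma hasimoto_t:
  assumes t: "t \<in> I"
  shows "((\<lambda>t. hasimoto \<kappa> \<tau> t s) has_vector_derivative \<psi>_t t s) (at t)"
  unfolding hasimoto_eq E_def \<psi>_t_def
  by (rule has_vector_derivative_phase[OF has_vector_derivative_of_real[OF dt[OF t smooth(1)]] phase_t[OF t]])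

lemma cmod_hasimoto: "(cmod (hasimoto \<kappa> \<tau> t s))\<^sup>2 = (k (t, s))\<^sup>2"
  by (simp add: hasimoto_eq norm_mult E_def)

text \<open>Up to the common factor \<open>E t s\<close>, the real part is the definition of f
  multiplied by \<kappa> and the imaginary part is the curvature equation. The term with A(t) comes
  from the lower boundary value f (t, 0) in \<open>phase_t\<close>.\<close>

lemma hasimoto_equation:
  assumes t: "t \<in> I"
  shows "- \<i> * \<psi>_t t s = \<psi>_ss t s + 1/2 * complex_of_real ((cmod (hasimoto \<kappa> \<tau> t s))\<^sup>2) * hasimoto \<kappa> \<tau> t s
    - hasimoto \<kappa> \<tau> t s * complex_of_real (hasimoto_potential \<kappa> \<tau> t)"
proof -
  define c ks kss v vs A F where vars: "c = complex_of_real (k (t, s))" "ks = complex_of_real (dird dir_s k (t, s))"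
    "kss = complex_of_real (dird dir_s (dird dir_s k) (t, s))" "v = complex_of_real (u (t, s))"
    "vs = complex_of_real (dird dir_s u (t, s))" "A = complex_of_real (f (t, 0))"
    "F = complex_of_real (f (t, s))"
  \<comment> \<open>Multiplying by \<kappa> removes the quotient before passing to complex numbers,
    so that only ring identities remain.\<close>
  have "k (t, s) * f (t, s) = dird dir_s (dird dir_s k) (t, s) - k (t, s) * (u (t, s))\<^sup>2 + k (t, s) * (k (t, s))\<^sup>2 / 2"
    using nonzero[OF t, of s] by (simp add: f field_simps)
  from arg_cong[OF this, of complex_of_real] have F: "c * F = kss - c * v\<^sup>2 + c * c\<^sup>2 / 2"
    by (simp add: vars)
  have "- \<i> * (- (2 * ks * v + c * vs) + \<i> * (F - A) * c) = c * F - c * A + \<i> * (2 * ks * v + c * vs)"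
    by (simp add: algebra_simps)
  also have "\<dots> = ((kss + \<i> * (vs * c + v * ks)) + \<i> * v * (ks + \<i> * v * c)) + 1/2 * c\<^sup>2 * c - c * A"
    unfolding F by (simp add: algebra_simps power2_eq_square)
  finally have *: "- \<i> * (- (2 * ks * v + c * vs) + \<i> * (F - A) * c) =
    ((kss + \<i> * (vs * c + v * ks)) + \<i> * v * (ks + \<i> * v * c)) + 1/2 * c\<^sup>2 * c - c * A" .
  have "- \<i> * \<psi>_t t s = (- \<i> * (- (2 * ks * v + c * vs) + \<i> * (F - A) * c)) * E t s"
    by (simp add: \<psi>_t_def curvature[OF t] vars)
  also have "\<dots> = ((kss + \<i> * (vs * c + v * ks)) + \<i> * v * (ks + \<i> * v * c)) * E t s
      + 1/2 * c\<^sup>2 * (c * E t s) - (c * E t s) * A"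
    unfolding * by (simp add: algebra_simps)
  finally show ?thesis
    unfolding cmod_hasimoto
    by (simp add: \<psi>_ss_def hasimoto_eq potential[OF t] vars)
qed

lemma partials_hasimoto:
  assumes t: "t \<in> I"
  shows "partial_t (hasimoto \<kappa> \<tau>) t s = \<psi>_t t s"
    and "partial_s (hasimoto \<kappa> \<tau>) t = \<psi>_s t"
    and "partial_s (partial_s (hasimoto \<kappa> \<tau>)) t s = \<psi>_ss t s"
    and "has_partials (hasimoto \<kappa> \<tau>) t s"
proof -
  show 1: "partial_t (hasimoto \<kappa> \<tau>) t s = \<psi>_t t s"
    unfolding partial_t_def by (rule vector_derivative_at[OF hasimoto_t[OF t]])
  show 2: "partial_s (hasimoto \<kappa> \<tau>) t = \<psi>_s t"
    unfolding partial_s_def using vector_derivative_at[OF hasimoto_s[OF t]] by auto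
  show "partial_s (partial_s (hasimoto \<kappa> \<tau>)) t s = \<psi>_ss t s"
    unfolding partial_s_def[of "partial_s (hasimoto \<kappa> \<tau>)"] 2
    by (rule vector_derivative_at[OF hasimoto_ss[OF t]])
  show "has_partials (hasimoto \<kappa> \<tau>) t s"
    unfolding has_partials_def 2
    using hasimoto_t[OF t] hasimoto_s[OF t] hasimoto_ss[OF t] differentiableI_vector by blast
qed

section \<open>The gauge factor and the gauged wave function\<close>

definition \<Theta> :: "real \<Rightarrow> real" where "\<Theta> t = (LBINT x=0..t. hasimoto_potential \<kappa> \<tau> x)"

lemma gauge_t:
  assumes t: "t \<in> I"
  shows "(\<Theta> has_vector_derivative hasimoto_potential \<kappa> \<tau> t) (at t)"
proof -
  \<comment> \<open>The midpoint between \<bar>t\<bar> and \<epsilon>: continuity of the potential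
    is available only inside the open interval, and [-b, b] is a compact part of it with 0 and t in
    its interior.\<close>
  define b where "b = (\<bar>t\<bar> + \<epsilon>) / 2"
  have b: "\<bar>t\<bar> < b" "b < \<epsilon>" using t by (auto simp: b_def)
  have sub: "{-b..b} \<subseteq> I" using b by auto
  have "continuous_on {-b..b} (\<lambda>t. f (t, 0))"
    by (rule continuous_on_compose2[OF smooth_on_continuous_on[OF smooth_f]])
      (use sub in \<open>auto intro!: continuous_intros\<close>)
  moreover have "continuous_on {-b..b} (\<lambda>t. f (t, 0)) = continuous_on {-b..b} (hasimoto_potential \<kappa> \<tau>)"
    by (rule continuous_on_cong) (use sub potential in auto)
  ultimately show ?thesis
    using has_vector_derivative_interval_integral[of "-b" b "hasimoto_potential \<kappa> \<tau>" 0 t] b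
    by (auto simp: \<Theta>_def[abs_def] zero_ereal_def)
qed

definition H :: "real \<Rightarrow> complex" where "H t = exp (\<i> * complex_of_real (\<Theta> t))"

lemma gauged_eq: "gauged_hasimoto \<kappa> \<tau> t s = hasimoto \<kappa> \<tau> t s * H t"
  by (simp add: gauged_hasimoto_def H_def \<Theta>_def)

lemma gauged_t:
  assumes t: "t \<in> I"
  shows "((\<lambda>t. gauged_hasimoto \<kappa> \<tau> t s) has_vector_derivative
    (\<psi>_t t s + \<i> * of_real (hasimoto_potential \<kappa> \<tau> t) * hasimoto \<kappa> \<tau> t s) * H t) (at t)"
  unfolding gauged_eq H_def by (rule has_vector_derivative_phase[OF hasimoto_t[OF t] gauge_t[OF t]])

lemma gauged_s:
  assumes t: "t \<in> I"
  shows "(gauged_hasimoto \<kappa> \<tau> t has_vector_derivative \<psi>_s t s * H t) (at s)"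
    and "((\<lambda>s. \<psi>_s t s * H t) has_vector_derivative \<psi>_ss t s * H t) (at s)"
  unfolding gauged_eq[abs_def]
  by (intro has_vector_derivative_mult_left hasimoto_s[OF t] hasimoto_ss[OF t])+

lemma partials_gauged:
  assumes t: "t \<in> I"
  shows "partial_t (gauged_hasimoto \<kappa> \<tau>) t s =
      (\<psi>_t t s + \<i> * of_real (hasimoto_potential \<kappa> \<tau> t) * hasimoto \<kappa> \<tau> t s) * H t"
    and "partial_s (partial_s (gauged_hasimoto \<kappa> \<tau>)) t s = \<psi>_ss t s * H t"
    and "has_partials (gauged_hasimoto \<kappa> \<tau>) t s"
proof -
  show "partial_t (gauged_hasimoto \<kappa> \<tau>) t s =
      (\<psi>_t t s + \<i> * of_real (hasimoto_potential \<kappa> \<tau> t) * hasimoto \<kappa> \<tau> t s) * H t"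
    unfolding partial_t_def by (rule vector_derivative_at[OF gauged_t[OF t]])
  have 2: "partial_s (gauged_hasimoto \<kappa> \<tau>) t = (\<lambda>s. \<psi>_s t s * H t)"
    unfolding partial_s_def using vector_derivative_at[OF gauged_s(1)[OF t]] by auto
  show "partial_s (partial_s (gauged_hasimoto \<kappa> \<tau>)) t s = \<psi>_ss t s * H t"
    unfolding partial_s_def[of "partial_s (gauged_hasimoto \<kappa> \<tau>)"] 2
    by (rule vector_derivative_at[OF gauged_s(2)[OF t]])
  show "has_partials (gauged_hasimoto \<kappa> \<tau>) t s"
    unfolding has_partials_def 2
    using gauged_t[OF t] gauged_s[OF t] differentiableI_vector by blast
qed

text \<open>Differentiating \<open>H t\<close> adds i A(t) times the gauged function to the
  t-derivative; after multiplication by -i this cancels the term with A(t). The s-derivatives see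
  \<open>H t\<close> as a constant, and its modulus is 1.\<close>

lemma gauged_equation:
  assumes t: "t \<in> I"
  shows "- \<i> * partial_t (gauged_hasimoto \<kappa> \<tau>) t s =
    partial_s (partial_s (gauged_hasimoto \<kappa> \<tau>)) t s
    + 1/2 * complex_of_real ((cmod (gauged_hasimoto \<kappa> \<tau> t s))\<^sup>2) * gauged_hasimoto \<kappa> \<tau> t s"
proof -
  have c: "cmod (gauged_hasimoto \<kappa> \<tau> t s) = cmod (hasimoto \<kappa> \<tau> t s)"
    by (simp add: gauged_eq norm_mult H_def)
  have "- \<i> * partial_t (gauged_hasimoto \<kappa> \<tau>) t s =
      (- \<i> * \<psi>_t t s + of_real (hasimoto_potential \<kappa> \<tau> t) * hasimoto \<kappa> \<tau> t s) * H t"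
    by (simp add: partials_gauged[OF t] algebra_simps)
  also have "\<dots> = (\<psi>_ss t s + 1/2 * complex_of_real ((cmod (hasimoto \<kappa> \<tau> t s))\<^sup>2) * hasimoto \<kappa> \<tau> t s) * H t"
    unfolding hasimoto_equation[OF t] by (simp add: algebra_simps)
  finally show ?thesis
    unfolding c partials_gauged(2)[OF t] by (simp add: gauged_eq[of t s] algebra_simps)
qed

end

section \<open>Curves in a manifold\<close>

context oriented_riemannian_3manifold
begin

lemma chart_domain_riemannian:
  assumes "c \<in> atlas"
  shows "riemannian_domain (snd c ` fst c) (g c)"
  using chart_image metric_smooth metric_symmetric metric_positive assms by unfold_locales auto

lemma open_chart_preimage:
  assumes cont: "continuous_map (top_of_set (I \<times> UNIV)) X (\<lambda>(t, s). \<alpha> t s)"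
    and I: "open I" and c: "c \<in> atlas"
  shows "open {(t :: real, s :: real). t \<in> I \<and> \<alpha> t s \<in> fst c}"
proof -
  have "openin (top_of_set (I \<times> UNIV)) {p \<in> topspace (top_of_set (I \<times> UNIV)). (\<lambda>(t, s). \<alpha> t s) p \<in> fst c}"
    by (rule openin_continuous_map_preimage[OF cont chart_domain[OF c]])
  moreover have "{p \<in> topspace (top_of_set (I \<times> UNIV)). (\<lambda>(t, s). \<alpha> t s) p \<in> fst c}
      = {(t, s). t \<in> I \<and> \<alpha> t s \<in> fst c}" by auto
  ultimately have "openin (top_of_set (I \<times> UNIV)) {(t, s). t \<in> I \<and> \<alpha> t s \<in> fst c}"
    by (rule back_subst)
  then show ?thesis
    by (rule openin_open_eq[OF open_Times[OF I open_UNIV], THEN iffD1, THEN conjunct1])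
qed

end

text \<open>The functions \<kappa> and \<tau> are common to all charts, and the open sets
  \<open>U c\<close> cover the strip of parameters. Smoothness and both evolution equations are
  local in (t, s), so the results in single charts suffice.\<close>

lemma hasimoto_evolution_of_vortex_filament:
  fixes X :: "'m topology" and atlas :: "'m chart set" and \<alpha> :: "real \<Rightarrow> real \<Rightarrow> 'm"
  assumes manifold: "oriented_riemannian_3manifold X atlas g"
    and curvature: "constant_curvature atlas g"
    and \<epsilon>: "0 < \<epsilon>"
    and cont: "continuous_map (top_of_set ({-\<epsilon><..<\<epsilon>} \<times> UNIV)) X (\<lambda>(t, s). \<alpha> t s)"
    and smooth_charts: "\<And>c. c \<in> atlas \<Longrightarrow> smooth_on {(t, s). t \<in> {-\<epsilon><..<\<epsilon>} \<and> \<alpha> t s \<in> fst c} (\<lambda>(t, s). snd c (\<alpha> t s))"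
    and trace: "\<And>t. t \<in> {-\<epsilon><..<\<epsilon>} \<Longrightarrow> nowhere_zero_trace_sff atlas g (\<alpha> t)"
    and arclength: "\<And>t. t \<in> {-\<epsilon><..<\<epsilon>} \<Longrightarrow> parameterized_by_arclength atlas g (\<alpha> t)"
    and frenet: "\<And>t. t \<in> {-\<epsilon><..<\<epsilon>} \<Longrightarrow> has_curvature_torsion atlas g (\<alpha> t) (\<kappa> t) (\<tau> t)"
    and vortex: "vortex_filament_solution atlas g \<epsilon> \<alpha> \<kappa>"
  shows "\<exists>k u f. hasimoto_evolution \<epsilon> \<kappa> \<tau> k u f"
proof -
  interpret oriented_riemannian_3manifold X atlas g by (rule manifold)
  define I where "I = {-\<epsilon><..<\<epsilon>}"
  define k u f where kuf: "k = (\<lambda>p :: real \<times> real. \<kappa> (fst p) (snd p))"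
    "u = (\<lambda>p :: real \<times> real. \<tau> (fst p) (snd p))"
    "f = (\<lambda>p. dird dir_s (dird dir_s k) p / k p - (u p)\<^sup>2 + (k p)\<^sup>2 / 2)"
  define U where "U c = {(t, s). t \<in> I \<and> \<alpha> t s \<in> fst c}" for c :: "'m chart"
  obtain K where K: "\<forall>c\<in>atlas. \<forall>x\<in>snd c ` fst c. \<forall>u v. u \<noteq> v \<and> independent {u, v} \<longrightarrow>
      sectional_curvature (g c) x u v = K"
    using curvature unfolding constant_curvature_def by (elim exE)
  have U: "open (U c)" if "c \<in> atlas" for c
    unfolding U_def I_def by (rule open_chart_preimage[OF cont open_greaterThanLessThan that])
  have cover: "\<exists>c\<in>atlas. p \<in> U c" if "p \<in> I \<times> UNIV" for p
  proof -
    have "\<alpha> (fst p) (snd p) \<in> topspace X"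
      using continuous_map_image_subset_topspace[OF cont] that by (auto simp: I_def)
    then show ?thesis using charts_cover that by (fastforce simp: U_def)
  qed
  have chart: "frenet_chart (snd c ` fst c) (g c) (U c) (\<lambda>(t, s). snd c (\<alpha> t s)) \<kappa> \<tau> K"
    if c: "c \<in> atlas" for c
  proof -
    interpret riemannian_domain "snd c ` fst c" "g c" by (rule chart_domain_riemannian[OF c])
    show ?thesis
    proof unfold_locales
      show "open (U c)" by (rule U[OF c])
      show "smooth_on (U c) (\<lambda>(t, s). snd c (\<alpha> t s))"
        using smooth_charts[OF c] by (simp add: U_def I_def)
      show "constant_sectional K"
        unfolding constant_sectional_def by (rule bspec[OF K c])
    next
      fix p assume "p \<in> U c"
      then show "(case p of (t, s) \<Rightarrow> snd c (\<alpha> t s)) \<in> snd c ` fst c" by (auto simp: U_def)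
    next
      fix t s assume "(t, s) \<in> U c"
      then have t: "t \<in> {-\<epsilon><..<\<epsilon>}" and \<alpha>: "\<alpha> t s \<in> fst c" by (auto simp: U_def I_def)
      show "metric_norm (g c) (case (t, s) of (t, s) \<Rightarrow> snd c (\<alpha> t s))
          (velocity (\<lambda>s. case (t, s) of (t, s) \<Rightarrow> snd c (\<alpha> t s)) s) = 1"
        using arclength[OF t] c \<alpha> by (simp add: parameterized_by_arclength_def comp_def)
      show "trace_sff (g c) (\<lambda>s. case (t, s) of (t, s) \<Rightarrow> snd c (\<alpha> t s)) s \<noteq> 0"
        using trace[OF t] c \<alpha> by (simp add: nowhere_zero_trace_sff_def comp_def)
      show "vector_derivative (\<lambda>r. case (r, s) of (t, s) \<Rightarrow> snd c (\<alpha> t s)) (at t)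
          = \<kappa> t s *\<^sub>R binormal (g c) (\<lambda>s. case (t, s) of (t, s) \<Rightarrow> snd c (\<alpha> t s)) s"
        using vortex t c \<alpha> by (simp add: vortex_filament_solution_def comp_def)
    qed (use frenet c in \<open>auto simp: has_curvature_torsion_def Let_def comp_def U_def I_def\<close>)
  qed
  have local: "smooth_on (U c) k \<and> smooth_on (U c) u \<and> (\<forall>p\<in>U c. k p \<noteq> 0 \<and>
      dird dir_t k p = - (2 * dird dir_s k p * u p + k p * dird dir_s u p) \<and>
      dird dir_t u p = dird dir_s f p)" if c: "c \<in> atlas" for c
  proof -
    interpret frenet_chart "snd c ` fst c" "g c" "U c" "\<lambda>(t, s). snd c (\<alpha> t s)" \<kappa> \<tau> K
      by (rule chart[OF c])
    show ?thesis
      using smooth_curvature smooth_torsion curvature_nonzero curvature_evolution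
        torsion_evolution_potential
      unfolding kuf k_def[abs_def] u_def[abs_def] by blast
  qed
  have glob: "smooth_on (I \<times> UNIV) k" "smooth_on (I \<times> UNIV) u"
    by (rule smooth_on_local; use cover U local in blast)+
  have "hasimoto_evolution \<epsilon> \<kappa> \<tau> k u f"
  proof
    fix t s assume "t \<in> {-\<epsilon><..<\<epsilon>}"
    then obtain c where c: "c \<in> atlas" "(t, s) \<in> U c" using cover[of "(t, s)"] by (auto simp: I_def)
    show "k (t, s) \<noteq> 0"
      "dird dir_t k (t, s) = - (2 * dird dir_s k (t, s) * u (t, s) + k (t, s) * dird dir_s u (t, s))"
      "dird dir_t u (t, s) = dird dir_s f (t, s)"
      using local[OF c(1)] c(2) by auto
  qed (use kuf \<epsilon> glob in \<open>auto simp: I_def\<close>)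
  then show ?thesis by blast
qed

theorem mainTheorem1:
  fixes X :: "'m topology"
    and atlas :: "'m chart set"
    and g :: "'m chart \<Rightarrow> metric_coeffs"
    and \<alpha> :: "real \<Rightarrow> real \<Rightarrow> 'm"
    and \<epsilon> L :: real
    and \<kappa> \<tau> :: "real \<Rightarrow> real \<Rightarrow> real"
  defines "\<psi> \<equiv> hasimoto \<kappa> \<tau>"
    and "A \<equiv> hasimoto_potential \<kappa> \<tau>"
    and "\<Psi> \<equiv> gauged_hasimoto \<kappa> \<tau>"
  assumes manifold: "oriented_riemannian_3manifold X atlas g"
    and curvature: "constant_curvature atlas g"
    and \<epsilon>: "0 < \<epsilon>"
    and L: "0 < L"
    and embedding: "time_dependent_embedding X atlas \<epsilon> L \<alpha>"
    and trace: "\<And>t. t \<in> {-\<epsilon><..<\<epsilon>} \<Longrightarrow> nowhere_zero_trace_sff atlas g (\<alpha> t)"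
    and arclength: "\<And>t. t \<in> {-\<epsilon><..<\<epsilon>} \<Longrightarrow> parameterized_by_arclength atlas g (\<alpha> t)"
    and frenet: "\<And>t. t \<in> {-\<epsilon><..<\<epsilon>} \<Longrightarrow> has_curvature_torsion atlas g (\<alpha> t) (\<kappa> t) (\<tau> t)"
    and vortex: "vortex_filament_solution atlas g \<epsilon> \<alpha> \<kappa>"
  shows "(\<forall>t\<in>{-\<epsilon><..<\<epsilon>}. \<forall>s. has_partials \<psi> t s \<and>
            - \<i> * partial_t \<psi> t s =
            partial_s (partial_s \<psi>) t s + 1/2 * complex_of_real ((cmod (\<psi> t s))\<^sup>2) * \<psi> t s
            - \<psi> t s * complex_of_real (A t)) \<and>
         (\<forall>t\<in>{-\<epsilon><..<\<epsilon>}. \<forall>s. has_partials \<Psi> t s \<and>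
            - \<i> * partial_t \<Psi> t s =
            partial_s (partial_s \<Psi>) t s + 1/2 * complex_of_real ((cmod (\<Psi> t s))\<^sup>2) * \<Psi> t s)"
proof -
  have "\<exists>k u f. hasimoto_evolution \<epsilon> \<kappa> \<tau> k u f"
    using embedding unfolding time_dependent_embedding_def
    by (intro hasimoto_evolution_of_vortex_filament[OF manifold curvature \<epsilon> _ _ trace arclength
          frenet vortex]) auto
  then obtain k u f where "hasimoto_evolution \<epsilon> \<kappa> \<tau> k u f" by blast
  then interpret hasimoto_evolution \<epsilon> \<kappa> \<tau> k u f .
  show ?thesis
    unfolding \<psi>_def A_def \<Psi>_def
    using partials_hasimoto hasimoto_equation partials_gauged(3) gauged_equation by auto
qed

end
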